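(* Let $ABC$ be a triangle in the hyperbolic plane. Let $M_a, M_b, M_c$ be points on the sides $BC$, $CA$, $AB$ respectively such that each of the segments $AM_a$, $BM_b$, $CM_c$ divides triangle $ABC$ into two triangles of equal hyperbolic area. Assume that $M_a, M_b, M_c$ lie on a hyperbolic circle $\Omega$ and that the three escribed circles of $ABC$ exist. Then $\Omega$ is tangent to the inscribed circle of triangle $ABC$ and to each of the three escribed circles of triangle $ABC$.
   Context: The inscribed circle of a triangle is the circle inside the triangle tangent to its three sides. The escribed circle opposite $A$ is a circle tangent to the three lines $BC$, $CA$, $AB$, lying in the angle $BAC$ on the other side of line $BC$ from $A$; the escribed circles opposite $B$ and $C$ are defined analogously. Two circles are tangent if they have exactly one common point (where they have a common tangent line); the degenerate case where the two circles coincide is also counted as tangency (for an equilateral triangle $\Omega$ coincides with the inscribed circle). *)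

theory Defs
  imports "HOL-Analysis.Analysis"
begin

text \<open>
  The hyperbolic plane of curvature \<open>-1\<close> in the Beltrami--Klein model: the points are those of the
  open unit disc and the geodesics are its chords.  Lines, segments and triangles are therefore the
  intersections with the disc of affine lines, closed segments and convex hulls; distance and area
  are not Euclidean, and circles of the model are in general Euclidean ellipses.
\<close>

type_synonym point = "real^2"

definition hplane :: "point set" where
  "hplane = ball 0 1"

definition hline :: "point \<Rightarrow> point \<Rightarrow> point set" where
  "hline P Q = affine hull {P, Q} \<inter> hplane"

definition hdist :: "point \<Rightarrow> point \<Rightarrow> real" where
  "hdist P Q = arcosh ((1 - P \<bullet> Q) / (sqrt (1 - P \<bullet> P) * sqrt (1 - Q \<bullet> Q)))"

text \<open>
  The metric tensor at \<open>z\<close> is \<open>((1 - |z|\<^sup>2) I + z z\<^sup>T) / (1 - |z|\<^sup>2)\<^sup>2\<close>, whose determinant is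
  \<open>(1 - |z|\<^sup>2) powr -3\<close>; the area density is the square root of this determinant.
\<close>

definition harea :: "point set \<Rightarrow> real" where
  "harea S = set_lebesgue_integral lborel S (\<lambda>z. 1 / sqrt (1 - z \<bullet> z) ^ 3)"

definition htriangle :: "point \<Rightarrow> point \<Rightarrow> point \<Rightarrow> bool" where
  "htriangle A B C \<longleftrightarrow> A \<in> hplane \<and> B \<in> hplane \<and> C \<in> hplane \<and> \<not> collinear {A, B, C}"

definition hcircle :: "point \<Rightarrow> real \<Rightarrow> point set" where
  "hcircle c r = {z \<in> hplane. hdist c z = r}"

definition is_hcircle :: "point set \<Rightarrow> bool" where
  "is_hcircle S \<longleftrightarrow> (\<exists>c r. c \<in> hplane \<and> r > 0 \<and> S = hcircle c r)"

definition hangle :: "point \<Rightarrow> point \<Rightarrow> point \<Rightarrow> point set" where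
  "hangle B A C = {A + s *\<^sub>R (B - A) + t *\<^sub>R (C - A) | s t. 0 \<le> s \<and> 0 \<le> t} \<inter> hplane"

text \<open>The closed half-plane bounded by the line \<open>PQ\<close> that does not contain \<open>A\<close>
  (for \<open>A\<close> not on the line).\<close>

definition other_side :: "point \<Rightarrow> point \<Rightarrow> point \<Rightarrow> point set" where
  "other_side A P Q = {X \<in> hplane. closed_segment A X \<inter> hline P Q \<noteq> {}}"

text \<open>Tangency to lines and circles is to be used for \<open>S\<close> and \<open>T\<close> that are circles.\<close>

definition tangent_line_at :: "point set \<Rightarrow> point \<Rightarrow> point \<Rightarrow> point \<Rightarrow> bool" where
  "tangent_line_at S P Q X \<longleftrightarrow> S \<inter> hline P Q = {X}"

definition tangent_line :: "point set \<Rightarrow> point \<Rightarrow> point \<Rightarrow> bool" where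
  "tangent_line S P Q \<longleftrightarrow> (\<exists>X. tangent_line_at S P Q X)"

definition tangent_side :: "point set \<Rightarrow> point \<Rightarrow> point \<Rightarrow> bool" where
  "tangent_side S P Q \<longleftrightarrow> (\<exists>X \<in> closed_segment P Q. tangent_line_at S P Q X)"

definition tangent_circles :: "point set \<Rightarrow> point set \<Rightarrow> bool" where
  "tangent_circles S T \<longleftrightarrow> S = T \<or> (\<exists>X. S \<inter> T = {X})"

definition inscribed_circle :: "point set \<Rightarrow> point \<Rightarrow> point \<Rightarrow> point \<Rightarrow> bool" where
  "inscribed_circle S A B C \<longleftrightarrow>
     is_hcircle S \<and> S \<subseteq> convex hull {A, B, C} \<and>
     tangent_side S B C \<and> tangent_side S C A \<and> tangent_side S A B"

text \<open>The escribed circle opposite the first of the three vertices.\<close>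

definition escribed_circle :: "point set \<Rightarrow> point \<Rightarrow> point \<Rightarrow> point \<Rightarrow> bool" where
  "escribed_circle S A B C \<longleftrightarrow>
     is_hcircle S \<and> S \<subseteq> hangle B A C \<and> S \<subseteq> other_side A B C \<and>
     tangent_line S B C \<and> tangent_line S C A \<and> tangent_line S A B"

definition area_bisector_foot :: "point \<Rightarrow> point \<Rightarrow> point \<Rightarrow> point \<Rightarrow> bool" where
  "area_bisector_foot M A B C \<longleftrightarrow>
     M \<in> closed_segment B C \<and>
     harea (convex hull {A, B, M}) = harea (convex hull {A, M, C})"

end

(*
  On the hyperboloid, a circle is the section by a plane <u, w> = 1 (w its pole). Integrating the area
  density gives tan(area/2) = det(a, b, c) / (1 + <a, b> + <b, c> + <c, a>), and from it the feet of the
  area bisectors. With x, y, z the cosh of the half-sides, a circle through the three feet must have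
  <a, w> = y z / x, <b, w> = z x / y, <c, w> = x y / z. For the inscribed circle the products of the pole
  with the vertices are the cosh of the tangent lengths s - a, s - b, s - c; the escribed circles arise
  by reversing the sign of one side. Circles with poles w, w' are tangent when
  (1 - <w, w>) (1 - <w', w'>) = (1 - <w, w'>)^2, and expanding these products by the inverse
  Gram matrix of a, b, c turns this into an identity of hyperbolic functions.
*)

theory Submission
  imports Defs
begin

section \<open>Area of a triangle\<close>

text \<open>Tangency is given only as "exactly one common point", so equations must be drawn from it
  for lines and turned back into it for circles. On a tangent line the quadratic equation of the
  circle has a double root; this yields tangent lengths with a sign, and the signs separate
  inscribed from escribed circles. For two circles a contact vector is built in the span of the
  poles. A circle of radius r has <w, w> = 1 / cosh(r)^2, so 1 - <w, w> is tanh(r)^2. The final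
  identity works because, after multiplication by the Gram determinant of a, b, c, the numbers 1 -
  <w, w>, 1 - <w', w'>, 1 - <w, w'> become 4 H^2, 4 S^2 and 4 H S, where H is the product of the
  sinh of the half-sides and S that of the signed tangent lengths. The values <a, w>, <b, w>, <c, w>
  are forced because a suitably scaled deviation from them depends on the vertex alone, and each
  foot says that the deviations at two vertices cancel.\<close>

lemma radial_antiderivative:
  fixes a d e r :: real
  defines "\<pi> \<equiv> \<lambda>r. sqrt (1 - (a + 2*r*e + r\<^sup>2*d))" and "h \<equiv> \<lambda>r. 1 - (a + r*e)"
  assumes a: "a < 1" and P: "a + 2*r*e + r\<^sup>2*d < 1" and h: "h r > 0"
  shows "((\<lambda>r. r\<^sup>2 / (\<pi> r * (h r + sqrt (1 - a) * \<pi> r))) has_real_derivative r / \<pi> r ^ 3) (at r within X)"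
proof -
  define p where "p = \<pi> r"
  define al where "al = sqrt (1 - a)"
  have p: "p > 0" "p\<^sup>2 = 1 - (a + 2*r*e + r\<^sup>2*d)" using P by (auto simp: p_def \<pi>_def)
  have al: "al > 0" "al\<^sup>2 = 1 - a" using a by (auto simp: al_def)
  define p' where "p' = - (e + r*d) / p"
  have pp': "p * p' = - (e + r*d)" using p by (simp add: p'_def)
  have dp: "(\<pi> has_real_derivative p') (at r within X)"
    unfolding p'_def \<pi>_def p_def using P by (auto intro!: derivative_eq_intros simp: field_simps)
  \<comment> \<open>Origin of the primitive r^2 / F: since h^2 - (1 - a) \<pi>^2 = r^2 (e^2 + (1 -
    a) d), it equals (h / \<pi> - sqrt(1 - a)) / (e^2 + (1 - a) d), a multiple of cosh(distance) -
    1. The form with F avoids dividing by e^2 + (1 - a) d and visibly vanishes at r = 0.\<close>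
  define F where "F = (\<lambda>r. \<pi> r * (h r + al * \<pi> r))"
  define F' where "F' = p' * (h r + al * p) + p * (- e + al * p')"
  have dF: "(F has_real_derivative F') (at r within X)"
    unfolding F_def F'_def h_def p_def by (auto intro!: derivative_eq_intros dp simp: algebra_simps)
  have Fr: "F r = p * (h r + al * p)" by (simp add: F_def p_def)
  have pos: "F r > 0" unfolding Fr using p al h by (intro mult_pos_pos add_pos_pos) auto
  have "(2*r*F r - r\<^sup>2*F') * p = r * (h r + al*p)\<^sup>2"
    using pp' p(2) al(2) unfolding Fr F'_def h_def by algebra
  then have "(2*r*F r - r\<^sup>2*F') * p^3 = r * (F r)\<^sup>2"
    unfolding Fr by algebra
  then have "(2*r*F r - r\<^sup>2*F') / (F r)\<^sup>2 = r / p^3"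
    using pos p by (simp add: frac_eq_eq)
  moreover have "((\<lambda>r. r\<^sup>2 / F r) has_real_derivative (2*r*F r - r\<^sup>2*F') / (F r)\<^sup>2) (at r within X)"
    using pos by (auto intro!: derivative_eq_intros dF simp: power2_eq_square)
  ultimately show ?thesis by (simp add: F_def p_def al_def)
qed

text \<open>The primitive is the area formula itself, for the triangle A, B, P with P = B + t (C -
  B): t D is the determinant and Q the denominator belonging to that triangle. The formula is thus
  confirmed by differentiating it while P slides along BC. Real letters replace the inner products,
  which leaves polynomial identities to check.\<close>

lemma angular_antiderivative:
  fixes a b d e f g t D :: real
  defines "\<pi> \<equiv> \<lambda>t. sqrt (1 - (b + 2*t*e + t\<^sup>2*d))" and "h \<equiv> \<lambda>t. 1 - (g + t*f)" and "k \<equiv> \<lambda>t. 1 - (b + t*e)"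
  defines "\<alpha> \<equiv> sqrt (1 - a)" and "\<beta> \<equiv> sqrt (1 - b)"
  defines "Q \<equiv> \<lambda>t. \<alpha>*\<beta>*\<pi> t + \<pi> t * (1 - g) + \<beta> * h t + \<alpha> * k t"
  assumes a: "a < 1" and b: "b < 1" and P: "b + 2*t*e + t\<^sup>2*d < 1" and h: "h t > 0" and k: "k t > 0" and g: "g < 1"
    and D: "D\<^sup>2 = - (1-a)*(1-b)*d + 2*(1-g)*e*f - (1-a)*e\<^sup>2 - (1-b)*f\<^sup>2 + d*(1-g)\<^sup>2"
  shows "((\<lambda>t. 2 * arctan (t*D / Q t)) has_real_derivative D / (\<pi> t * (h t + \<alpha> * \<pi> t))) (at t within X)"
proof -
  define p where "p = \<pi> t"
  have p: "p > 0" "p\<^sup>2 = 1 - (b + 2*t*e + t\<^sup>2*d)" using P by (auto simp: p_def \<pi>_def)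
  have al: "\<alpha> > 0" "\<alpha>\<^sup>2 = 1 - a" using a by (auto simp: \<alpha>_def)
  have be: "\<beta> > 0" "\<beta>\<^sup>2 = 1 - b" using b by (auto simp: \<beta>_def)
  define p' where "p' = - (e + t*d) / p"
  have pp': "p * p' = - (e + t*d)" using p by (simp add: p'_def)
  have dp: "(\<pi> has_real_derivative p') (at t within X)"
    unfolding p'_def \<pi>_def p_def using P by (auto intro!: derivative_eq_intros simp: field_simps)
  define Q' where "Q' = \<alpha>*\<beta>*p' + p'*(1-g) - \<beta>*f - \<alpha>*e"
  have dQ: "(Q has_real_derivative Q') (at t within X)"
    unfolding Q_def h_def k_def Q'_def by (auto intro!: derivative_eq_intros dp simp: algebra_simps)
  have Qpos: "Q t > 0" unfolding Q_def using p al be h k g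
    by (intro add_pos_pos mult_pos_pos) (auto simp: p_def)
  have Qs: "Q t = \<alpha>*\<beta>*p + p * (1 - g) + \<beta> * h t + \<alpha> * k t" by (simp add: Q_def p_def)
  \<comment> \<open>For three unit vectors with pairwise products A, B, C this is (1 + A + B + C)^2
    + det^2 = 2 (1 + A) (1 + B) (1 + C). Two of the factors reappear in \<open>num\<close> and
    cancel in the derivative of the arctangent.\<close>
  have sum: "(t*D)\<^sup>2 + (Q t)\<^sup>2 = 2 * (\<alpha>*\<beta> + (1-g)) * (\<alpha>*p + h t) * (\<beta>*p + k t)"
    using D p(2) al(2) be(2) unfolding Qs h_def k_def by algebra
  have num: "(Q t - t*Q') * p = (\<alpha>*\<beta> + (1-g)) * (\<beta>*p + k t)"
    using pp' p(2) al(2) be(2) unfolding Qs Q'_def h_def k_def by algebra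
  have pos: "\<alpha>*\<beta> + (1-g) > 0" "\<alpha>*p + h t > 0" "\<beta>*p + k t > 0"
    using al be p h k g by (simp_all add: add_pos_pos)
  have "((\<lambda>t. 2 * arctan (t*D / Q t)) has_real_derivative 2 * (((D * Q t - t*D*Q') / (Q t)\<^sup>2) / (1 + (t*D / Q t)\<^sup>2))) (at t within X)"
    using Qpos by (auto intro!: derivative_eq_intros dQ simp: field_simps power2_eq_square)
  also have "2 * (((D * Q t - t*D*Q') / (Q t)\<^sup>2) / (1 + (t*D / Q t)\<^sup>2)) = 2 * (D * (Q t - t*Q')) / ((t*D)\<^sup>2 + (Q t)\<^sup>2)"
  proof -
    have "1 + (t*D / Q t)\<^sup>2 = ((t*D)\<^sup>2 + (Q t)\<^sup>2) / (Q t)\<^sup>2"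
      using Qpos by (simp add: field_simps)
    then show ?thesis using Qpos by (simp add: right_diff_distrib mult.assoc mult.left_commute)
  qed
  also have "\<dots> = D / (p * (h t + \<alpha> * p))"
  proof -
    have 1: "Q t - t*Q' = (\<alpha>*\<beta> + (1-g)) * (\<beta>*p + k t) / p" using num p by (simp add: field_simps)
    have 2: "2 * (D * (u * w / p)) / (2 * u * v * w) = D / (p * v)" if "u > 0" "v > 0" "w > 0" for u v w
      using that by simp
    show ?thesis unfolding sum 1 2[OF pos] by (simp only: add.commute)
  qed
  finally show ?thesis by (simp add: p_def)
qed

section \<open>Iterated integrals in the plane and polar coordinates at a vertex\<close>

lemma cbox_vec2: "cbox (a::real^2) b = {v. a$1 \<le> v$1 \<and> v$1 \<le> b$1 \<and> a$2 \<le> v$2 \<and> v$2 \<le> b$2}"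
  by (auto simp: mem_box_cart forall_2)

lemma integral_vec2_iterated:
  fixes f :: "real^2 \<Rightarrow> real"
  assumes "continuous_on (cbox a b) f"
  shows "integral (cbox a b) f = integral {a$2..b$2} (\<lambda>y. integral {a$1..b$1} (\<lambda>x. f (vector [x, y])))"
proof -
  \<comment> \<open>The coordinates are swapped so that Fubini for pairs leaves the second
    coordinate outside. The maps \<open>g\<close> and \<open>h\<close> are mutually inverse and
    preserve area, hence the scale factor 1 below.\<close>
  define g where "g = (\<lambda>z::real\<times>real. vector [snd z, fst z] :: real^2)"
  define h where "h = (\<lambda>v::real^2. (v$2, v$1))"
  have gbox: "g ` cbox u v = cbox (g u) (g v)" for u v
  proof -
    have "cbox (g u) (g v) \<subseteq> g ` cbox u v"
    proof
      fix w assume "w \<in> cbox (g u) (g v)"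
      then have "w = g (w$2, w$1)" "(w$2, w$1) \<in> cbox u v"
        by (cases u; cases v; auto simp: g_def cbox_vec2 vec_eq_iff forall_2 cbox_Pair_eq)+
      then show "w \<in> g ` cbox u v" by blast
    qed
    moreover have "g ` cbox u v \<subseteq> cbox (g u) (g v)"
      by (cases u; cases v) (auto simp: g_def cbox_vec2 cbox_Pair_eq)
    ultimately show ?thesis by blast
  qed
  have hbox: "h ` cbox u v = cbox (h u) (h v)" for u v
  proof -
    have "cbox (h u) (h v) \<subseteq> h ` cbox u v"
    proof
      fix w assume "w \<in> cbox (h u) (h v)"
      then have "w = h (g w)" "g w \<in> cbox u v"
        by (cases w; auto simp: g_def h_def cbox_vec2 cbox_Pair_eq)+
      then show "w \<in> h ` cbox u v" by blast
    qed
    moreover have "h ` cbox u v \<subseteq> cbox (h u) (h v)"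
      by (auto simp: h_def cbox_vec2 cbox_Pair_eq)
    ultimately show ?thesis by blast
  qed
  have contg: "continuous_on X g" for X
  proof -
    have "g = (\<lambda>z. \<chi> i. if i = 1 then snd z else fst z)"
      by (auto simp: g_def vec_eq_iff forall_2)
    moreover have "continuous_on X (\<lambda>z. if i = (1::2) then snd z else fst z :: real)" for i
      by (cases "i = 1") (auto intro!: continuous_intros)
    ultimately show ?thesis by (simp only: continuous_on_vec_lambda)
  qed
  have int: "((\<lambda>z. f (g z)) has_integral (1/1) *\<^sub>R integral (cbox a b) f) (h ` cbox a b)"
  proof (rule has_integral_twiddle)
    show "continuous (at x) g" for x using contg[of UNIV] by (metis UNIV_I continuous_on_eq_continuous_at open_UNIV)
    show "\<exists>w z. g ` cbox u v = cbox w z" for u v using gbox by blast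
    show "\<exists>w z. h ` cbox u v = cbox w z" for u v using hbox by blast
    show "measure lborel (g ` cbox u v) = 1 * measure lborel (cbox u v)" for u v
    proof -
      obtain p q p' q' where uv: "u = (p, q)" "v = (p', q')" by (cases u, cases v) auto
      show ?thesis
      proof (cases "p \<le> p' \<and> q \<le> q'")
        case True
        then have "vector [q, p] \<in> cbox (g u) (g v)" by (simp add: uv g_def cbox_vec2)
        then have "cbox (g u) (g v) \<noteq> {}" by blast
        with True show ?thesis
          unfolding gbox by (simp add: content_cbox_cart uv content_Pair UNIV_2 g_def)
      next
        case False
        then have "cbox u v = {}" by (auto simp: uv cbox_Pair_eq)
        then show ?thesis by simp
      qed
    qed
    show "(f has_integral integral (cbox a b) f) (cbox a b)"
      using assms integrable_continuous integrable_integral by blast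
  qed (auto simp: g_def h_def vec_eq_iff forall_2)
  have "integral (cbox a b) f = integral (cbox (a$2, a$1) (b$2, b$1)) (\<lambda>z. f (g z))"
    using integral_unique[OF int] unfolding hbox by (simp add: h_def)
  also have "\<dots> = integral (cbox (a$2) (b$2)) (\<lambda>y. integral (cbox (a$1) (b$1)) (\<lambda>x. f (g (y, x))))"
  proof (rule integral_prod_continuous)
    have "g ` cbox (a$2, a$1) (b$2, b$1) = cbox a b"
      unfolding gbox by (auto simp: g_def cbox_vec2)
    then show "continuous_on (cbox (a$2, a$1) (b$2, b$1)) (\<lambda>z. f (g z))"
      using continuous_on_compose2[OF assms contg] by auto
  qed
  finally show ?thesis by (simp add: g_def)
qed

text \<open>This is the determinant with rows (1, A), (1, B), (1, C). Divided by the square roots of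
  1 - |A|^2, 1 - |B|^2, 1 - |C|^2 it becomes det(a, b, c) for the lifted points.\<close>

definition cross2 :: "point \<Rightarrow> point \<Rightarrow> point \<Rightarrow> real" where
  "cross2 A B C = (B$1 - A$1) * (C$2 - A$2) - (B$2 - A$2) * (C$1 - A$1)"

text \<open>The unit square is mapped onto the triangle with one edge collapsed to A. The Jacobian
  contributes the weight r, which is what makes the radial integral of the hyperbolic density
  elementary.\<close>

lemma integral_triangle_polar:
  fixes A B C :: point and f :: "point \<Rightarrow> real"
  assumes nz: "cross2 A B C \<noteq> 0" and cont: "continuous_on (convex hull {A, B, C}) f"
  shows "integral (convex hull {A, B, C}) f =
    integral {0..1} (\<lambda>t. \<bar>cross2 A B C\<bar> * integral {0..1} (\<lambda>r. r * f (A + r *\<^sub>R ((B - A) + t *\<^sub>R (C - B)))))"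
proof -
  define D where "D = cross2 A B C"
  define T where "T = convex hull {A, B, C}"
  define g where "g = (\<lambda>v::point. A + v$1 *\<^sub>R ((B - A) + v$2 *\<^sub>R (C - B)))"
  define g' where "g' = (\<lambda>(v::point) (w::point). w$1 *\<^sub>R ((B - A) + v$2 *\<^sub>R (C - B)) + v$1 *\<^sub>R (w$2 *\<^sub>R (C - B)))"
  \<comment> \<open>The edge that collapses to A is removed to make \<open>g\<close> injective;
    neither this edge nor the point A affects an integral.\<close>
  define S where "S = cbox 0 (1::point) - {v. v$1 = 0}"
  have T: "T = {A + x *\<^sub>R ((B - A) + y *\<^sub>R (C - B)) | x y. 0 \<le> x \<and> x \<le> 1 \<and> 0 \<le> y \<and> y \<le> 1}" (is "_ = ?R")
  proof
    show "?R \<subseteq> T"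
    proof clarify
      fix x y :: real assume xy: "0 \<le> x" "x \<le> 1" "0 \<le> y" "y \<le> 1"
      have "A + x *\<^sub>R ((B - A) + y *\<^sub>R (C - B)) = A + (x * (1 - y)) *\<^sub>R (B - A) + (x * y) *\<^sub>R (C - A)"
        by (simp add: algebra_simps)
      moreover have "x * (1 - y) + x * y \<le> 1" using xy by (simp add: algebra_simps)
      ultimately show "A + x *\<^sub>R ((B - A) + y *\<^sub>R (C - B)) \<in> T"
        unfolding T_def convex_hull_3_alt using xy
        by (intro CollectI exI[of _ "x * (1-y)"] exI[of _ "x * y"]) auto
    qed
    show "T \<subseteq> ?R"
      unfolding T_def convex_hull_3_alt
    proof clarify
      fix u v :: real assume uv: "0 \<le> u" "0 \<le> v" "u + v \<le> 1"
      show "\<exists>x y. A + u *\<^sub>R (B - A) + v *\<^sub>R (C - A) = A + x *\<^sub>R ((B - A) + y *\<^sub>R (C - B)) \<and> 0 \<le> x \<and> x \<le> 1 \<and> 0 \<le> y \<and> y \<le> 1"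
      proof (cases "u + v = 0")
        case True
        then have "u = 0" "v = 0" using uv by auto
        then show ?thesis by (intro exI[of _ 0]) auto
      next
        case False
        then have pos: "u + v > 0" using uv by auto
        have "(u + v) *\<^sub>R ((B - A) + (v/(u+v)) *\<^sub>R (C - B)) = (u+v) *\<^sub>R (B - A) + v *\<^sub>R (C - B)"
          using pos by (simp add: scaleR_add_right)
        then have "A + u *\<^sub>R (B - A) + v *\<^sub>R (C - A) = A + (u+v) *\<^sub>R ((B - A) + (v/(u+v)) *\<^sub>R (C - B))"
          by (simp add: algebra_simps)
        then show ?thesis using uv pos by (intro exI[of _ "u+v"] exI[of _ "v/(u+v)"]) auto
      qed
    qed
  qed
  have gbox: "g ` cbox 0 1 = T"
  proof -
    have "A + x *\<^sub>R ((B - A) + y *\<^sub>R (C - B)) \<in> g ` cbox 0 1" if "0 \<le> x" "x \<le> 1" "0 \<le> y" "y \<le> 1" for x y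
    proof (rule image_eqI)
      show "vector [x,y] \<in> cbox (0::point) 1" using that by (simp add: cbox_vec2)
    qed (simp add: g_def)
    then show ?thesis unfolding T by (auto simp: g_def cbox_vec2)
  qed
  have gS: "T - {A} \<subseteq> g ` S" "g ` S \<subseteq> T"
  proof -
    have "g v \<in> g ` S" if "v \<in> cbox 0 1" "g v \<noteq> A" for v
      using that by (auto simp: S_def g_def)
    then show "T - {A} \<subseteq> g ` S" unfolding gbox[symmetric] by auto
    show "g ` S \<subseteq> T" unfolding gbox[symmetric] S_def by auto
  qed
  have negS: "negligible {v::point. v$1 = 0}" by (rule negligible_standard_hyperplane_cart)
  have lebS: "S \<in> sets lebesgue"
    unfolding S_def using negS negligible_imp_sets by auto
  have der: "(g has_derivative g' v) (at v within X)" for v X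
    unfolding g_def g'_def by (rule derivative_eq_intros bounded_linear_imp_has_derivative[OF bounded_linear_vec_nth] refl | simp add: algebra_simps)+
  have detg: "det (matrix (g' v)) = v$1 * D" for v
    by (simp add: det_2 matrix_def g'_def axis_def D_def cross2_def algebra_simps)
  have inj: "inj_on g S"
  proof
    fix v w assume vw: "v \<in> S" "w \<in> S" "g v = g w"
    define x y where "x = v$1 - w$1" and "y = v$1 * v$2 - w$1 * w$2"
    have "g v $ i = g w $ i" for i using vw by simp
    from this[of 1] this[of 2] have
      "x * (B$1 - A$1) + y * (C$1 - B$1) = 0" "x * (B$2 - A$2) + y * (C$2 - B$2) = 0"
      by (simp_all add: g_def x_def y_def algebra_simps)
    then have "x * D = 0" "y * D = 0" unfolding D_def cross2_def by algebra+
    then have "x = 0" "y = 0" using nz by (auto simp: D_def)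
    then show "v = w" using vw by (auto simp: S_def x_def y_def vec_eq_iff forall_2)
  qed
  have compT: "compact T" unfolding T_def by (simp add: finite_imp_compact_convex_hull)
  have fT: "f absolutely_integrable_on T"
  proof -
    have "integrable lborel (\<lambda>x. indicator T x *\<^sub>R f x)"
      by (rule borel_integrable_compact[OF compT]) (use cont in \<open>simp add: T_def\<close>)
    then show ?thesis
      unfolding set_integrable_def by (meson borel_measurable_integrable integrable_completion)
  qed
  have "f absolutely_integrable_on g ` S \<longleftrightarrow> f absolutely_integrable_on T"
    by (rule absolutely_integrable_spike_set_eq) (use gS in \<open>auto intro: negligible_subset[OF negligible_sing[of A]]\<close>)
  with fT have fgS: "f absolutely_integrable_on g ` S" by simp
  have "integral T f = integral (g ` S) f"
    by (rule integral_spike_set) (use gS in \<open>auto intro: negligible_subset[OF negligible_sing[of A]]\<close>)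
  also have "\<dots> = integral S (\<lambda>v. \<bar>v$1 * D\<bar> * f (g v))"
    \<comment> \<open>The change of variables concerns integrands with values in
      \<open>real^n\<close>, so \<open>f\<close> passes through \<open>real^1\<close>.\<close>
    using has_absolute_integral_change_of_variables[OF lebS der inj, of "\<lambda>z. vec (f z) :: real^1" "vec (integral (g ` S) f)"] fgS
    unfolding detg by (simp add: absolutely_integrable_on_1_iff integral_on_1_eq vec_eq_iff)
  also have "\<dots> = integral (cbox 0 1) (\<lambda>v. \<bar>v$1 * D\<bar> * f (g v))"
    by (rule integral_spike_set) (use negS in \<open>auto simp: S_def intro: negligible_subset\<close>)
  also have "\<dots> = integral {0..1} (\<lambda>t. integral {0..1} (\<lambda>r. \<bar>r * D\<bar> * f (A + r *\<^sub>R ((B - A) + t *\<^sub>R (C - B)))))"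
  proof -
    have "continuous_on (cbox 0 1) (\<lambda>v. f (g v))"
      by (rule continuous_on_compose2[OF cont]) (use gbox in \<open>auto simp: T_def g_def intro!: continuous_intros\<close>)
    then have "continuous_on (cbox 0 1) (\<lambda>v. \<bar>v$1 * D\<bar> * f (g v))"
      by (intro continuous_intros)
    from integral_vec2_iterated[OF this] show ?thesis by (simp add: g_def)
  qed
  also have "\<dots> = integral {0..1} (\<lambda>t. \<bar>D\<bar> * integral {0..1} (\<lambda>r. r * f (A + r *\<^sub>R ((B - A) + t *\<^sub>R (C - B)))))"
  proof (rule integral_cong)
    fix t :: real assume "t \<in> {0..1}"
    have "integral {0..1} (\<lambda>r. \<bar>r * D\<bar> * f (A + r *\<^sub>R ((B - A) + t *\<^sub>R (C - B)))) 
       = integral {0..1} (\<lambda>r. \<bar>D\<bar> * (r * f (A + r *\<^sub>R ((B - A) + t *\<^sub>R (C - B)))))"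
      by (rule integral_cong) (auto simp: abs_mult)
    then show "integral {0..1} (\<lambda>r. \<bar>r * D\<bar> * f (A + r *\<^sub>R ((B - A) + t *\<^sub>R (C - B)))) 
       = \<bar>D\<bar> * integral {0..1} (\<lambda>r. r * f (A + r *\<^sub>R ((B - A) + t *\<^sub>R (C - B))))"
      by simp
  qed
  finally show ?thesis by (simp add: T_def D_def)
qed

section \<open>Inequalities in the disc and evaluation of the area integral\<close>

lemma hplane_iff: "P \<in> hplane \<longleftrightarrow> P \<bullet> P < 1"
  by (simp add: hplane_def dist_norm norm_eq_sqrt_inner)

lemma convex_hplane: "convex hplane"
  by (simp add: hplane_def)

lemma hplane_sqrt_pos: "P \<in> hplane \<Longrightarrow> sqrt (1 - P \<bullet> P) > 0"
  by (simp add: hplane_iff)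

text \<open>The reversed Cauchy-Schwarz inequality for future timelike vectors: with x^2 = 1 - |P|^2
  and y^2 = 1 - |Q|^2, the nonnegative quantity (x - y)^2 + |P - Q|^2 equals 2 (1 - P.Q) - 2 x
  y.\<close>

lemma hplane_inner_ge:
  assumes "P \<in> hplane" "Q \<in> hplane"
  shows "1 - P \<bullet> Q \<ge> sqrt (1 - P \<bullet> P) * sqrt (1 - Q \<bullet> Q)"
proof -
  define x y where "x = sqrt (1 - P \<bullet> P)" and "y = sqrt (1 - Q \<bullet> Q)"
  have x: "x\<^sup>2 = 1 - P \<bullet> P" "y\<^sup>2 = 1 - Q \<bullet> Q"
    using assms by (simp_all add: x_def y_def hplane_iff)
  have "(x - y)\<^sup>2 + (P - Q) \<bullet> (P - Q) \<ge> 0" by simp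
  then have "2 * (x * y) \<le> 2 * (1 - P \<bullet> Q)"
    using x by (simp add: power2_diff inner_diff inner_commute)
  then show ?thesis by (simp add: x_def y_def)
qed

lemma hplane_inner_pos:
  assumes "P \<in> hplane" "Q \<in> hplane"
  shows "1 - P \<bullet> Q > 0"
  using hplane_inner_ge[OF assms] mult_pos_pos[OF hplane_sqrt_pos[OF assms(1)] hplane_sqrt_pos[OF assms(2)]]
  by linarith

lemma segment_in_hplane:
  assumes "P \<in> hplane" "Q \<in> hplane" "0 \<le> t" "t \<le> 1"
  shows "P + t *\<^sub>R (Q - P) \<in> hplane"
proof -
  have "P + t *\<^sub>R (Q - P) = (1 - t) *\<^sub>R P + t *\<^sub>R Q" by (simp add: algebra_simps)
  then show ?thesis using convexD_alt[OF convex_hplane assms(1,2)] assms(3,4) by simp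
qed

lemma inner_on_line:
  fixes P Q :: "'a::real_inner"
  shows "(P + t *\<^sub>R V) \<bullet> (P + t *\<^sub>R V) = P \<bullet> P + 2 * t * (P \<bullet> V) + t\<^sup>2 * (V \<bullet> V)"
  by (simp add: inner_add inner_commute power2_eq_square algebra_simps)

lemma radial_integral:
  assumes A: "A \<in> hplane" and P: "P \<in> hplane"
  shows "integral {0..1} (\<lambda>r. r * (1 / sqrt (1 - (A + r *\<^sub>R (P - A)) \<bullet> (A + r *\<^sub>R (P - A))) ^ 3))
    = 1 / (sqrt (1 - P \<bullet> P) * (1 - A \<bullet> P + sqrt (1 - A \<bullet> A) * sqrt (1 - P \<bullet> P)))"
proof -
  define a e d where "a = A \<bullet> A" and "e = A \<bullet> (P - A)" and "d = (P - A) \<bullet> (P - A)"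
  define G where "G = (\<lambda>r. r\<^sup>2 / (sqrt (1 - (a + 2*r*e + r\<^sup>2*d)) * ((1 - (a + r*e)) + sqrt (1 - a) * sqrt (1 - (a + 2*r*e + r\<^sup>2*d)))))"
  have q: "(A + r *\<^sub>R (P - A)) \<bullet> (A + r *\<^sub>R (P - A)) = a + 2*r*e + r\<^sup>2*d" for r
    unfolding a_def e_def d_def by (rule inner_on_line)
  have h: "A \<bullet> (A + r *\<^sub>R (P - A)) = a + r*e" for r
    by (simp add: a_def e_def inner_add_right)
  have "((\<lambda>r. r / sqrt (1 - (a + 2*r*e + r\<^sup>2*d)) ^ 3) has_integral G 1 - G 0) {0..1}"
  proof (rule fundamental_theorem_of_calculus)
    fix r :: real assume "r \<in> {0..1}"
    then have rP: "A + r *\<^sub>R (P - A) \<in> hplane" using segment_in_hplane[OF A P] by simp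
    then have "a + 2*r*e + r\<^sup>2*d < 1" "1 - (a + r*e) > 0" "a < 1"
      using hplane_inner_pos[OF A rP] A unfolding hplane_iff q h by (simp_all add: a_def)
    then show "(G has_vector_derivative r / sqrt (1 - (a + 2*r*e + r\<^sup>2*d)) ^ 3) (at r within {0..1})"
      using radial_antiderivative unfolding G_def has_real_derivative_iff_has_vector_derivative by blast
  qed simp
  moreover have "G 0 = 0" by (simp add: G_def)
  moreover have "G 1 = 1 / (sqrt (1 - P \<bullet> P) * (1 - A \<bullet> P + sqrt (1 - A \<bullet> A) * sqrt (1 - P \<bullet> P)))"
    using q[of 1] h[of 1] by (simp add: G_def a_def)
  ultimately show ?thesis unfolding q by (simp add: integral_unique)
qed

text \<open>The inner integral runs from A to a point P of BC, the outer one moves P along BC.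
  Dividing numerator and denominator by \<alpha> \<beta> \<gamma> turns the fraction into |det(a, b,
  c)| / (1 + <a, b> + <a, c> + <b, c>).\<close>

theorem harea_triangle:
  assumes A: "A \<in> hplane" and B: "B \<in> hplane" and C: "C \<in> hplane" and nz: "cross2 A B C \<noteq> 0"
  defines "\<alpha> \<equiv> sqrt (1 - A \<bullet> A)" and "\<beta> \<equiv> sqrt (1 - B \<bullet> B)" and "\<gamma> \<equiv> sqrt (1 - C \<bullet> C)"
  shows "harea (convex hull {A, B, C}) = 2 * arctan (\<bar>cross2 A B C\<bar> /
    (\<alpha> * \<beta> * \<gamma> + \<gamma> * (1 - A \<bullet> B) + \<beta> * (1 - A \<bullet> C) + \<alpha> * (1 - B \<bullet> C)))"
proof -
  define f where "f = (\<lambda>z::point. 1 / sqrt (1 - z \<bullet> z) ^ 3)"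
  define T where "T = convex hull {A, B, C}"
  define a b e d g k where "a = A \<bullet> A" and "b = B \<bullet> B" and "e = B \<bullet> (C - B)" and "d = (C - B) \<bullet> (C - B)"
    and "g = A \<bullet> B" and "k = A \<bullet> (C - B)"
  define D where "D = \<bar>cross2 A B C\<bar>"
  have sub: "T \<subseteq> hplane" unfolding T_def by (rule hull_minimal) (use A B C convex_hplane in auto)
  have contf: "continuous_on T f"
    unfolding f_def using sub by (auto intro!: continuous_intros simp: hplane_iff)
  have compT: "compact T" unfolding T_def by (simp add: finite_imp_compact_convex_hull)
  have "set_integrable lborel T f"
    unfolding set_integrable_def by (rule borel_integrable_compact[OF compT contf])
  then have "harea T = integral T f"
    unfolding harea_def f_def by (rule set_borel_integral_eq_integral(2))
  also have "\<dots> = integral {0..1} (\<lambda>t. D * integral {0..1} (\<lambda>r. r * f (A + r *\<^sub>R ((B - A) + t *\<^sub>R (C - B)))))"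
    using integral_triangle_polar[OF nz contf[unfolded T_def]] by (simp add: T_def D_def)
  also have "\<dots> = integral {0..1} (\<lambda>t. D / (sqrt (1 - (b + 2*t*e + t\<^sup>2*d)) * ((1 - (g + t*k)) + sqrt (1 - a) * sqrt (1 - (b + 2*t*e + t\<^sup>2*d)))))"
  proof (rule integral_cong)
    fix t :: real assume t: "t \<in> {0..1}"
    define P where "P = B + t *\<^sub>R (C - B)"
    have "P \<in> hplane" using segment_in_hplane[OF B C] t by (simp add: P_def)
    note radial_integral[OF A this]
    moreover have PA: "(B - A) + t *\<^sub>R (C - B) = P - A" by (simp add: P_def)
    moreover have "P \<bullet> P = b + 2*t*e + t\<^sup>2*d" unfolding P_def b_def e_def d_def by (rule inner_on_line)
    moreover have "A \<bullet> P = g + t*k" by (simp add: P_def g_def k_def inner_add_right)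
    ultimately show "D * integral {0..1} (\<lambda>r. r * f (A + r *\<^sub>R ((B - A) + t *\<^sub>R (C - B)))) =
      D / (sqrt (1 - (b + 2*t*e + t\<^sup>2*d)) * ((1 - (g + t*k)) + sqrt (1 - a) * sqrt (1 - (b + 2*t*e + t\<^sup>2*d))))"
      unfolding PA f_def a_def by simp
  qed
  also have "\<dots> = 2 * arctan (D / (\<alpha> * \<beta> * \<gamma> + \<gamma> * (1 - A \<bullet> B) + \<beta> * (1 - A \<bullet> C) + \<alpha> * (1 - B \<bullet> C)))"
  proof -
    define G where "G = (\<lambda>t. 2 * arctan (t * D /
            (sqrt (1 - a) * sqrt (1 - b) * sqrt (1 - (b + 2*t*e + t\<^sup>2*d)) +
             sqrt (1 - (b + 2*t*e + t\<^sup>2*d)) * (1 - g) + sqrt (1 - b) * (1 - (g + t*k)) + sqrt (1 - a) * (1 - (b + t*e)))))"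
    have "((\<lambda>t. D / (sqrt (1 - (b + 2*t*e + t\<^sup>2*d)) * ((1 - (g + t*k)) + sqrt (1 - a) * sqrt (1 - (b + 2*t*e + t\<^sup>2*d)))))
      has_integral G 1 - G 0) {0..1}"
    proof (rule fundamental_theorem_of_calculus)
      fix t :: real assume t: "t \<in> {0..1}"
      define P where "P = B + t *\<^sub>R (C - B)"
      have P: "P \<in> hplane" using segment_in_hplane[OF B C] t by (simp add: P_def)
      moreover have "P \<bullet> P = b + 2*t*e + t\<^sup>2*d" unfolding P_def b_def e_def d_def by (rule inner_on_line)
      moreover have "A \<bullet> P = g + t*k" by (simp add: P_def g_def k_def inner_add_right)
      moreover have "B \<bullet> P = b + t*e" by (simp add: P_def b_def e_def inner_add_right)
      ultimately have pos: "b + 2*t*e + t\<^sup>2*d < 1" "1 - (g + t*k) > 0" "1 - (b + t*e) > 0" "g < 1" "a < 1" "b < 1"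
        using hplane_inner_pos[OF A P] hplane_inner_pos[OF B P] hplane_inner_pos[OF A B] A B
        by (simp_all add: hplane_iff g_def a_def b_def)
      \<comment> \<open>The right-hand side is the Gram determinant of (1, A), (1, B), (0, C - B)
        for the Minkowski product.\<close>
      have "D\<^sup>2 = - (1-a)*(1-b)*d + 2*(1-g)*e*k - (1-a)*e\<^sup>2 - (1-b)*k\<^sup>2 + d*(1-g)\<^sup>2"
        unfolding D_def power2_abs a_def b_def d_def e_def g_def k_def cross2_def inner_vec_def sum_2 inner_real_def
          vector_minus_component by algebra
      from angular_antiderivative[OF pos(5,6,1,2,3,4) this, of "{0..1}"]
      show "(G has_vector_derivative D / (sqrt (1 - (b + 2*t*e + t\<^sup>2*d)) * ((1 - (g + t*k)) + sqrt (1 - a) * sqrt (1 - (b + 2*t*e + t\<^sup>2*d)))))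
        (at t within {0..1})"
        unfolding G_def has_real_derivative_iff_has_vector_derivative .
    qed simp
    moreover have "G 0 = 0" by (simp add: G_def)
    moreover have "G 1 = 2 * arctan (D / (\<alpha> * \<beta> * \<gamma> + \<gamma> * (1 - A \<bullet> B) + \<beta> * (1 - A \<bullet> C) + \<alpha> * (1 - B \<bullet> C)))"
    proof -
      have "b + 2*1*e + 1\<^sup>2*d = C \<bullet> C" "g + 1*k = A \<bullet> C" "b + 1*e = B \<bullet> C"
        by (simp_all add: b_def e_def d_def g_def k_def inner_diff inner_commute)
      then show ?thesis by (simp add: G_def \<alpha>_def \<beta>_def \<gamma>_def a_def b_def g_def)
    qed
    ultimately show ?thesis by (simp add: integral_unique)
  qed
  finally show ?thesis by (simp add: T_def D_def)
qed

section \<open>Feet of the area bisectors\<close>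

text \<open>This excludes a foot at a vertex: one of the two triangles would degenerate to a
  segment, while the other would be the whole triangle, of positive area.\<close>

lemma harea_segment: "harea (closed_segment P Q) = 0"
proof -
  have "negligible (closed_segment P Q)"
    by (simp add: negligible_convex_interior interior_closed_segment_ge2)
  then have "closed_segment P Q \<in> null_sets lborel"
    by (simp add: negligible_iff_null_sets null_sets_completion_iff)
  then have "AE z in lborel. indicator (closed_segment P Q) z *\<^sub>R (1 / sqrt (1 - z \<bullet> z) ^ 3) = 0"
    using AE_not_in by (force simp: indicator_def elim: eventually_mono)
  then show ?thesis
    unfolding harea_def set_lebesgue_integral_def by (rule integral_eq_zero_AE)
qed

text \<open>The distance is the arcosh of this number; staying with the cosh keeps all later
  relations algebraic.\<close>

definition hcosh :: "point \<Rightarrow> point \<Rightarrow> real" where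
  "hcosh P Q = (1 - P \<bullet> Q) / (sqrt (1 - P \<bullet> P) * sqrt (1 - Q \<bullet> Q))"

definition hcosh_half :: "point \<Rightarrow> point \<Rightarrow> real" where
  "hcosh_half P Q = sqrt ((1 + hcosh P Q) / 2)"

lemma hcosh_commute: "hcosh P Q = hcosh Q P"
  by (simp add: hcosh_def inner_commute mult.commute)

lemma hcosh_ge_1:
  assumes "P \<in> hplane" "Q \<in> hplane"
  shows "hcosh P Q \<ge> 1"
  using hplane_inner_ge[OF assms] assms[THEN hplane_sqrt_pos] by (simp add: hcosh_def)

lemma hcosh_half_pos:
  assumes "P \<in> hplane" "Q \<in> hplane"
  shows "hcosh_half P Q > 0" "hcosh P Q = 2 * (hcosh_half P Q)\<^sup>2 - 1"
  using hcosh_ge_1[OF assms] by (auto simp: hcosh_half_def field_simps)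

lemma inner_hcosh:
  assumes "P \<in> hplane" "Q \<in> hplane"
  shows "1 - P \<bullet> Q = sqrt (1 - P \<bullet> P) * sqrt (1 - Q \<bullet> Q) * hcosh P Q"
  using hplane_sqrt_pos[OF assms(1)] hplane_sqrt_pos[OF assms(2)] by (simp add: hcosh_def)

lemma harea_triangle_pos:
  assumes "A \<in> hplane" "B \<in> hplane" "C \<in> hplane" "cross2 A B C \<noteq> 0"
  shows "harea (convex hull {A, B, C}) > 0"
  unfolding harea_triangle[OF assms]
  using assms(4) assms(1-3)[THEN hplane_sqrt_pos] hplane_inner_pos[OF assms(1,2)] hplane_inner_pos[OF assms(1,3)]
    hplane_inner_pos[OF assms(2,3)]
  by (auto intro!: divide_pos_pos add_pos_pos mult_pos_pos)

text \<open>With \<open>(1, M) = p b + q c\<close> for the lifts \<open>b, c\<close> of \<open>B, C\<close> to the hyperboloid, equality of the areas reads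
  \<open>y\<^sup>2 q u = z\<^sup>2 p v\<close> with \<open>u v = 4 p q x\<^sup>2\<close>, where \<open>u\<close> and \<open>v\<close> are the left-hand sides below.\<close>

lemma area_bisector_foot_position:
  assumes A: "A \<in> hplane" and B: "B \<in> hplane" and C: "C \<in> hplane" and nz: "cross2 A B C \<noteq> 0"
    and foot: "area_bisector_foot M A B C"
  defines "x \<equiv> hcosh_half B C" and "y \<equiv> hcosh_half C A" and "z \<equiv> hcosh_half A B"
  obtains t where "0 < t" "t < 1" "M = B + t *\<^sub>R (C - B)"
    "sqrt (1 - M \<bullet> M) + t * sqrt (1 - C \<bullet> C) - (1 - t) * sqrt (1 - B \<bullet> B) = 2 * ((1 - t) * sqrt (1 - B \<bullet> B)) * (z * x / y)"
    "sqrt (1 - M \<bullet> M) + (1 - t) * sqrt (1 - B \<bullet> B) - t * sqrt (1 - C \<bullet> C) = 2 * (t * sqrt (1 - C \<bullet> C)) * (x * y / z)"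
proof -
  define D where "D = cross2 A B C"
  obtain t where t: "0 \<le> t" "t \<le> 1" and M: "M = B + t *\<^sub>R (C - B)"
    using foot by (auto simp: area_bisector_foot_def in_segment algebra_simps)
  have eq: "harea (convex hull {A, B, M}) = harea (convex hull {A, M, C})"
    using foot by (simp add: area_bisector_foot_def)
  have Mh: "M \<in> hplane" using segment_in_hplane[OF B C] t by (simp add: M)
  have "t \<noteq> 0"
    using eq harea_triangle_pos[OF A B C nz] harea_segment[of A B] by (auto simp: M segment_convex_hull)
  moreover have "t \<noteq> 1"
    using eq harea_triangle_pos[OF A B C nz] harea_segment[of A C] by (auto simp: M segment_convex_hull)
  ultimately have t: "0 < t" "t < 1" using t by auto
  have crs: "cross2 A B M = t * D" "cross2 A M C = (1 - t) * D"
    by (simp_all add: D_def M cross2_def algebra_simps)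
  define \<alpha> \<beta> \<gamma> \<pi> where "\<alpha> = sqrt (1 - A \<bullet> A)" and "\<beta> = sqrt (1 - B \<bullet> B)" and "\<gamma> = sqrt (1 - C \<bullet> C)"
    and "\<pi> = sqrt (1 - M \<bullet> M)"
  have pos: "\<alpha> > 0" "\<beta> > 0" "\<gamma> > 0" "\<pi> > 0"
    using A B C Mh by (simp_all add: \<alpha>_def \<beta>_def \<gamma>_def \<pi>_def hplane_iff)
  have sq: "\<beta>\<^sup>2 = 1 - B \<bullet> B" "\<gamma>\<^sup>2 = 1 - C \<bullet> C" "\<pi>\<^sup>2 = 1 - M \<bullet> M"
    using B C Mh by (simp_all add: \<beta>_def \<gamma>_def \<pi>_def hplane_iff less_imp_le)
  define p q where "p = (1 - t) * \<beta>" and "q = t * \<gamma>"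
  have pq: "p > 0" "q > 0" using t pos by (simp_all add: p_def q_def)
  have xyz: "x > 0" "y > 0" "z > 0"
    and AB: "1 - A \<bullet> B = \<alpha>*\<beta>*(2*z\<^sup>2 - 1)" and AC: "1 - A \<bullet> C = \<alpha>*\<gamma>*(2*y\<^sup>2 - 1)" and BC: "1 - B \<bullet> C = \<beta>*\<gamma>*(2*x\<^sup>2-1)"
    using hcosh_half_pos[OF B C] hcosh_half_pos[OF C A] hcosh_half_pos[OF A B] inner_hcosh[OF A B] inner_hcosh[OF A C] inner_hcosh[OF B C]
    by (simp_all add: x_def y_def z_def \<alpha>_def \<beta>_def \<gamma>_def hcosh_commute[of A C])
  have AM: "1 - A \<bullet> M = \<alpha> * (p * (2*z\<^sup>2 - 1) + q * (2*y\<^sup>2 - 1))"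
    and BM: "1 - B \<bullet> M = \<beta> * (p + q * (2*x\<^sup>2 - 1))"
    and MC: "1 - M \<bullet> C = \<gamma> * (q + p * (2*x\<^sup>2 - 1))"
  proof -
    have "1 - A \<bullet> M = (1 - t) * (1 - A \<bullet> B) + t * (1 - A \<bullet> C)"
      by (simp add: M inner_add_right inner_diff_right algebra_simps)
    then show "1 - A \<bullet> M = \<alpha> * (p * (2*z\<^sup>2 - 1) + q * (2*y\<^sup>2 - 1))"
      unfolding AB AC p_def q_def by (simp add: algebra_simps)
    have "1 - B \<bullet> M = (1 - t) * \<beta>\<^sup>2 + t * (1 - B \<bullet> C)"
      by (simp add: M sq inner_add_right inner_diff_right algebra_simps)
    then show "1 - B \<bullet> M = \<beta> * (p + q * (2*x\<^sup>2 - 1))"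
      unfolding BC p_def q_def by (simp add: algebra_simps power2_eq_square)
    have "1 - M \<bullet> C = (1 - t) * (1 - B \<bullet> C) + t * \<gamma>\<^sup>2"
      by (simp add: M sq inner_add_left inner_diff_left algebra_simps)
    then show "1 - M \<bullet> C = \<gamma> * (q + p * (2*x\<^sup>2 - 1))"
      unfolding BC p_def q_def by (simp add: algebra_simps power2_eq_square)
  qed
  \<comment> \<open>This is the Minkowski square of p b + q c, arranged so that u v below becomes
    the difference of squares \<pi>^2 - (q - p)^2.\<close>
  have pi2: "\<pi>\<^sup>2 = (q - p)\<^sup>2 + 4*p*q*x\<^sup>2"
  proof -
    have "1 - M \<bullet> M = (1 - t) * (1 - B \<bullet> M) + t * (1 - M \<bullet> C)"
      by (subst (2) M) (simp add: inner_add_right inner_diff_right inner_commute algebra_simps)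
    then show ?thesis
      unfolding sq BM MC p_def q_def by (simp add: algebra_simps power2_eq_square)
  qed
  define Q1 Q2 where
    "Q1 = \<alpha>*\<beta>*\<pi> + \<pi>*(1 - A \<bullet> B) + \<beta>*(1 - A \<bullet> M) + \<alpha>*(1 - B \<bullet> M)" and
    "Q2 = \<alpha>*\<pi>*\<gamma> + \<gamma>*(1 - A \<bullet> M) + \<pi>*(1 - A \<bullet> C) + \<alpha>*(1 - M \<bullet> C)"
  have Qpos: "Q1 > 0" "Q2 > 0"
    unfolding Q1_def Q2_def using pos hplane_inner_pos[OF A B] hplane_inner_pos[OF A C] hplane_inner_pos[OF A Mh]
      hplane_inner_pos[OF B Mh] hplane_inner_pos[OF Mh C] by (simp_all add: add_pos_pos)
  have "arctan (\<bar>t * D\<bar> / Q1) = arctan (\<bar>(1 - t) * D\<bar> / Q2)"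
    using eq harea_triangle[OF A B Mh] harea_triangle[OF A Mh C] nz t
    by (simp add: crs Q1_def Q2_def \<alpha>_def \<beta>_def \<gamma>_def \<pi>_def D_def)
  then have "t * \<bar>D\<bar> * Q2 = (1 - t) * \<bar>D\<bar> * Q1"
    using t Qpos by (simp add: arctan_eq_iff abs_mult frac_eq_eq)
  then have "\<bar>D\<bar> * (t * Q2) = \<bar>D\<bar> * ((1 - t) * Q1)" by (simp only: mult_ac)
  then have "t * Q2 = (1 - t) * Q1" using nz by (simp add: D_def)
  moreover have "t * Q2 = \<alpha> * q * (2*\<pi>*y\<^sup>2 + 2*q*y\<^sup>2 + p*(2*z\<^sup>2 + 2*x\<^sup>2 - 2))"
    unfolding Q2_def AM AC MC q_def by algebra
  moreover have "(1 - t) * Q1 = \<alpha> * p * (2*\<pi>*z\<^sup>2 + 2*p*z\<^sup>2 + q*(2*y\<^sup>2 + 2*x\<^sup>2 - 2))"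
    unfolding Q1_def AM AB BM p_def by algebra
  ultimately have main: "q * (2*\<pi>*y\<^sup>2 + 2*q*y\<^sup>2 + p*(2*z\<^sup>2 + 2*x\<^sup>2 - 2)) = p * (2*\<pi>*z\<^sup>2 + 2*p*z\<^sup>2 + q*(2*y\<^sup>2 + 2*x\<^sup>2 - 2))"
    using pos by (simp add: mult.assoc)
  define u v where "u = \<pi> + q - p" and "v = \<pi> + p - q"
  have uv: "u * v = 4*p*q*x\<^sup>2" using pi2 unfolding u_def v_def by algebra
  have yz: "y\<^sup>2 * q * u = z\<^sup>2 * p * v" using main unfolding u_def v_def by algebra
  \<comment> \<open>A positive product and the positive sum u + v = 2 \<pi> make both factors
    positive, which fixes the signs of the square roots taken next.\<close>
  have "u * v > 0" using uv pq xyz by simp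
  moreover have "u + v > 0" using pos by (simp add: u_def v_def)
  ultimately have uvpos: "u > 0" "v > 0" by (auto simp: zero_less_mult_iff)
  \<comment> \<open>Multiplying \<open>yz\<close> by u and replacing u v by \<open>uv\<close> leaves
    an equation between squares; multiplying by v instead gives the companion for z v.\<close>
  have "q * (y * u)\<^sup>2 = q * (2*p*(z*x))\<^sup>2" using uv yz by algebra
  then have "y * u = 2*p*(z*x)" using pq uvpos xyz by (simp add: power2_eq_iff_nonneg)
  moreover have "p * (z * v)\<^sup>2 = p * (2*q*(x*y))\<^sup>2" using uv yz by algebra
  then have "z * v = 2*q*(x*y)" using pq uvpos xyz by (simp add: power2_eq_iff_nonneg)
  ultimately have "u = 2 * p * (z * x / y)" "v = 2 * q * (x * y / z)"
    using xyz by (simp_all add: field_simps)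
  then show thesis
    using that[OF t M] by (simp add: u_def v_def p_def q_def \<pi>_def \<beta>_def \<gamma>_def)
qed

section \<open>Circles and tangency in the hyperboloid model\<close>

text \<open>A circle of radius r has k = cosh r * sqrt(1 - |c|^2). Absorbing the factor of the
  centre into k makes the condition linear in the lift of z.\<close>

definition circ :: "point \<Rightarrow> real \<Rightarrow> point set" where
  "circ c k = {z \<in> hplane. 1 - c \<bullet> z = k * sqrt (1 - z \<bullet> z)}"

lemma is_hcircle_circ:
  assumes "is_hcircle S"
  obtains c k where "c \<in> hplane" "k > 0" "S = circ c k"
proof -
  obtain c r where c: "c \<in> hplane" "r > 0" "S = hcircle c r"
    using assms by (auto simp: is_hcircle_def)
  have "S = circ c (cosh r * sqrt (1 - c \<bullet> c))"
  proof -
    have "hdist c z = r \<longleftrightarrow> 1 - c \<bullet> z = cosh r * sqrt (1 - c \<bullet> c) * sqrt (1 - z \<bullet> z)" if "z \<in> hplane" for z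
    proof -
      have "hdist c z = r \<longleftrightarrow> hcosh c z = cosh r"
        using hcosh_ge_1[OF c(1) that] c(2) cosh_arcosh_real[of "hcosh c z"] arcosh_cosh_real[of r]
        by (auto simp: hdist_def hcosh_def)
      then show ?thesis
        using hplane_sqrt_pos[OF c(1)] hplane_sqrt_pos[OF that] by (simp add: hcosh_def divide_eq_eq mult.assoc)
    qed
    then show ?thesis unfolding c(3) hcircle_def circ_def by auto
  qed
  moreover have "cosh r * sqrt (1 - c \<bullet> c) > 0"
    using hplane_sqrt_pos[OF c(1)] cosh_real_pos[of r] by (rule mult_pos_pos[rotated])
  ultimately show thesis using that[OF c(1)] by blast
qed

section \<open>Minkowski product, lifts of points and poles of circles\<close>

definition mink :: "real \<times> point \<Rightarrow> real \<times> point \<Rightarrow> real" where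
  "mink u v = fst u * fst v - snd u \<bullet> snd v"

lemma mink_simps:
  "mink u v = mink v u" "mink (u + w) v = mink u v + mink w v" "mink (u - w) v = mink u v - mink w v"
  "mink v (u + w) = mink v u + mink v w" "mink v (u - w) = mink v u - mink v w"
  "mink (r *\<^sub>R u) v = r * mink u v" "mink u (r *\<^sub>R v) = r * mink u v"
  by (simp_all add: mink_def inner_commute algebra_simps inner_add inner_diff)

text \<open>The orthogonal complement of a timelike vector is negative definite. If the time
  component e of d were nonzero, Cauchy-Schwarz would give a^2 e^2 = (U.E)^2 <= |U|^2 e^2 < a^2 e^2.
  Later this forces two poles, or two common points, to coincide.\<close>

lemma mink_timelike_complement:
  assumes u: "mink u u > 0" and ort: "mink u d = 0" and d: "mink d d \<ge> 0"
  shows "d = 0"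
proof -
  obtain a U where uU: "u = (a, U)" by (cases u)
  obtain e E where dE: "d = (e, E)" by (cases d)
  have 1: "a\<^sup>2 > U \<bullet> U" "a * e = U \<bullet> E" "E \<bullet> E \<le> e\<^sup>2"
    using assms by (simp_all add: uU dE mink_def power2_eq_square)
  have "e = 0"
  proof (rule ccontr)
    assume "e \<noteq> 0"
    then have "(U \<bullet> U) * e\<^sup>2 < a\<^sup>2 * e\<^sup>2" using 1 by simp
    also have "\<dots> = (U \<bullet> E)\<^sup>2" using 1(2) by (metis power_mult_distrib)
    also have "\<dots> \<le> (U \<bullet> U) * (E \<bullet> E)" by (rule Cauchy_Schwarz_ineq)
    also have "\<dots> \<le> (U \<bullet> U) * e\<^sup>2" using 1(3) by (simp add: mult_left_mono)
    finally show False by simp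
  qed
  then have "E \<bullet> E = 0" using 1(3) inner_ge_zero[of E] by simp
  then show ?thesis using \<open>e = 0\<close> by (simp add: dE zero_prod_def)
qed

definition lift :: "point \<Rightarrow> real \<times> point" where
  "lift P = (1 / sqrt (1 - P \<bullet> P)) *\<^sub>R (1, P)"

definition pole :: "point \<Rightarrow> real \<Rightarrow> real \<times> point" where
  "pole c k = (1 / k) *\<^sub>R (1, c)"

lemma mink_lift_lift: "mink (lift P) (lift Q) = hcosh P Q"
  by (simp add: lift_def mink_def hcosh_def diff_divide_distrib)

lemma mink_lift_self: "P \<in> hplane \<Longrightarrow> mink (lift P) (lift P) = 1"
  by (simp add: mink_lift_lift hcosh_def hplane_iff)

lemma mink_lift_pole: "mink (lift P) (pole c k) = (1 - c \<bullet> P) / (k * sqrt (1 - P \<bullet> P))"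
  by (simp add: lift_def pole_def mink_def diff_divide_distrib inner_commute mult.commute)

lemma mink_lift_pole_pos: "P \<in> hplane \<Longrightarrow> c \<in> hplane \<Longrightarrow> k > 0 \<Longrightarrow> mink (lift P) (pole c k) > 0"
  using hplane_inner_pos[of c P] hplane_sqrt_pos[of P] by (simp add: mink_lift_pole)

lemma mem_circ_iff: "k > 0 \<Longrightarrow> P \<in> circ c k \<longleftrightarrow> P \<in> hplane \<and> mink (lift P) (pole c k) = 1"
  using hplane_sqrt_pos[of P] by (auto simp: circ_def mink_lift_pole)

lemma mink_pole_pos: "c \<in> hplane \<Longrightarrow> k > 0 \<Longrightarrow> mink (pole c k) (pole c k) > 0"
  by (simp add: pole_def mink_def hplane_iff divide_strict_right_mono)

lemma pole_inj: "k > 0 \<Longrightarrow> pole c k = pole c' k' \<Longrightarrow> c = c' \<and> k = k'"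
  by (auto simp: pole_def)

text \<open>Unit vectors form two sheets; a positive product with a future timelike vector selects
  the upper one. On the lower sheet |a| <= |U.c|, so |c| < 1 and Cauchy-Schwarz would give a^2 <=
  |U|^2, against a^2 = 1 + |U|^2.\<close>

lemma future_unit_vector_is_lift:
  assumes c: "c \<in> hplane" "k > 0" and u: "mink u u = 1" "mink u (pole c k) > 0"
  obtains X where "X \<in> hplane" "u = lift X"
proof -
  obtain a U where uU: "u = (a, U)" by (cases u)
  have au: "a\<^sup>2 = 1 + U \<bullet> U" using u by (simp add: uU mink_def power2_eq_square)
  have "a > U \<bullet> c" using u c by (simp add: uU pole_def mink_def diff_divide_distrib[symmetric] zero_less_divide_iff)
  have "a > 0"
  proof (rule ccontr)
    assume "\<not> a > 0"
    then have "\<bar>a\<bar> \<le> \<bar>U \<bullet> c\<bar>" using \<open>a > U \<bullet> c\<close> by linarith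
    then have "a\<^sup>2 \<le> (U \<bullet> c)\<^sup>2" by (simp add: abs_le_square_iff)
    also have "\<dots> \<le> (U \<bullet> U) * (c \<bullet> c)" by (rule Cauchy_Schwarz_ineq)
    also have "\<dots> \<le> (U \<bullet> U) * 1" using c by (intro mult_left_mono) (auto simp: hplane_iff)
    finally show False using au by simp
  qed
  define X where "X = (1/a) *\<^sub>R U"
  have XX: "1 - X \<bullet> X = (1/a)\<^sup>2" 
  proof -
    have "X \<bullet> X = (a\<^sup>2 - 1) / a\<^sup>2" using au by (simp add: X_def power2_eq_square)
    then show ?thesis using \<open>a > 0\<close> by (simp add: field_simps)
  qed
  then have "X \<bullet> X < 1" using \<open>a > 0\<close> by (smt (verit) zero_less_divide_1_iff zero_less_power)
  moreover have "u = lift X"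
    unfolding lift_def XX using \<open>a > 0\<close> by (simp add: uU X_def)
  ultimately show thesis using that by (simp add: hplane_iff)
qed

lemma lift_inj: "P \<in> hplane \<Longrightarrow> lift P = lift Q \<Longrightarrow> P = Q"
  by (auto simp: lift_def hplane_iff)

text \<open>If the poles are independent, one vector u of their span has product 1 with both, and
  <u, u> = (n + n' - 2 m) / (n n' - m^2). The hypothesis says that this is 1, so u is a common
  point. Any other common point Z has <Z, u> = 1, so Z - u is isotropic and orthogonal to the
  timelike \<omega>, hence zero.\<close>

lemma tangent_circ_circ:
  assumes c: "c \<in> hplane" "k > 0" and c': "c' \<in> hplane" "k' > 0"
    and tang: "(1 - mink (pole c k) (pole c k)) * (1 - mink (pole c' k') (pole c' k')) = (1 - mink (pole c k) (pole c' k'))\<^sup>2"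
  shows "tangent_circles (circ c k) (circ c' k')"
proof -
  define \<omega> \<omega>' where "\<omega> = pole c k" and "\<omega>' = pole c' k'"
  define n n' m where "n = mink \<omega> \<omega>" and "n' = mink \<omega>' \<omega>'" and "m = mink \<omega> \<omega>'"
  have n: "n > 0" using mink_pole_pos[OF c] by (simp add: n_def \<omega>_def)
  have eq: "n + n' - 2*m = n*n' - m\<^sup>2"
    using tang unfolding \<omega>_def[symmetric] \<omega>'_def[symmetric] n_def[symmetric] n'_def[symmetric] m_def[symmetric]
    by algebra
  show ?thesis
  proof (cases "n * n' - m\<^sup>2 = 0")
    case True
    \<comment> \<open>Here n + n' = 2 m and m^2 = n n', so n = n' = m. The difference of the poles
      is then isotropic and orthogonal to \<omega>: the circles coincide.\<close>
    then have "(n - n')\<^sup>2 = 0" using eq by algebra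
    then have "n' = n" "m = n" using eq True by simp_all
    then have "mink \<omega> (\<omega> - \<omega>') = 0" "mink (\<omega> - \<omega>') (\<omega> - \<omega>') = 0"
      using mink_simps(1)[of \<omega>' \<omega>] by (simp_all add: mink_simps(2-) n_def n'_def m_def)
    then have "\<omega> - \<omega>' = 0" using mink_timelike_complement[of \<omega> "\<omega> - \<omega>'"] n unfolding n_def by linarith
    then have "pole c k = pole c' k'" by (simp add: \<omega>_def \<omega>'_def)
    from pole_inj[OF c(2) this] show ?thesis by (simp add: tangent_circles_def)
  next
    case False
    \<comment> \<open>Cramer's rule for <u, \<omega>> = <u, \<omega>'> = 1.\<close>
    define s t where "s = (n' - m) / (n * n' - m\<^sup>2)" and "t = (n - m) / (n * n' - m\<^sup>2)"
    define u where "u = s *\<^sub>R \<omega> + t *\<^sub>R \<omega>'"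
    have st: "s + t = 1" using False eq by (simp add: s_def t_def add_divide_distrib[symmetric])
    have u1: "mink u \<omega> = 1"
    proof -
      have "mink u \<omega> = s * n + t * m" using mink_simps(1)[of \<omega>' \<omega>] by (simp add: u_def mink_simps(2-) n_def m_def)
      also have "\<dots> = ((n' - m) * n + (n - m) * m) / (n * n' - m\<^sup>2)" by (simp add: s_def t_def add_divide_distrib)
      also have "(n' - m) * n + (n - m) * m = n * n' - m\<^sup>2" by algebra
      finally show ?thesis using False by simp
    qed
    have u2: "mink u \<omega>' = 1"
    proof -
      have "mink u \<omega>' = s * m + t * n'" by (simp add: u_def mink_simps(2-) n'_def m_def)
      also have "\<dots> = ((n' - m) * m + (n - m) * n') / (n * n' - m\<^sup>2)" by (simp add: s_def t_def add_divide_distrib)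
      also have "(n' - m) * m + (n - m) * n' = n * n' - m\<^sup>2" by algebra
      finally show ?thesis using False by simp
    qed
    have ul: "mink w u = s * mink w \<omega> + t * mink w \<omega>'" for w by (simp add: u_def mink_simps(2-))
    have uu: "mink u u = 1" unfolding ul u1 u2 using st by simp
    obtain X where X: "X \<in> hplane" "u = lift X"
      using future_unit_vector_is_lift[OF c uu] u1 by (auto simp: \<omega>_def)
    have "Z = X" if "Z \<in> circ c k" "Z \<in> circ c' k'" for Z
    proof -
      have Z: "Z \<in> hplane" "mink (lift Z) \<omega> = 1" "mink (lift Z) \<omega>' = 1"
        using that c c' by (simp_all add: mem_circ_iff \<omega>_def \<omega>'_def)
      have "mink (lift Z) u = 1" unfolding ul Z using st by simp
      then have "mink (lift Z - u) (lift Z - u) = 0"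
        using mink_lift_self[OF Z(1)] uu mink_simps(1)[of u "lift Z"] by (simp add: mink_simps(2-))
      moreover have "mink \<omega> (lift Z - u) = 0"
        using Z u1 mink_simps(1)[of \<omega>] by (simp add: mink_simps(2-))
      ultimately have "lift Z - u = 0" using mink_timelike_complement[of \<omega> "lift Z - u"] n unfolding n_def by linarith
      then show ?thesis using lift_inj[OF Z(1)] X by simp
    qed
    moreover have "X \<in> circ c k" "X \<in> circ c' k'"
      using X u1 u2 c c' by (simp_all add: mem_circ_iff \<omega>_def \<omega>'_def)
    ultimately have "circ c k \<inter> circ c' k' = {X}" by blast
    then show ?thesis by (auto simp: tangent_circles_def)
  qed
qed

text \<open>Squaring adds no points: a solution outside the open disc would have |z| = 1 and c.z =
  1, impossible for |c| < 1, and inside it 1 - c.z is positive. Hence any root found on a line is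
  automatically a point of the circle.\<close>

lemma mem_circ_quadratic:
  assumes c: "c \<in> hplane" "k > 0"
  shows "z \<in> circ c k \<longleftrightarrow> k\<^sup>2 * (1 - z \<bullet> z) = (1 - c \<bullet> z)\<^sup>2"
proof
  assume "z \<in> circ c k"
  then show "k\<^sup>2 * (1 - z \<bullet> z) = (1 - c \<bullet> z)\<^sup>2"
    by (auto simp: circ_def power_mult_distrib hplane_iff)
next
  assume eq: "k\<^sup>2 * (1 - z \<bullet> z) = (1 - c \<bullet> z)\<^sup>2"
  have "z \<bullet> z < 1"
  proof (rule ccontr)
    assume "\<not> z \<bullet> z < 1"
    moreover have "k\<^sup>2 * (1 - z \<bullet> z) \<ge> 0" using eq by simp
    ultimately have zz: "z \<bullet> z = 1" using c by (simp add: zero_le_mult_iff)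
    then have "c \<bullet> z = 1" using eq by simp
    then have "1 \<le> (c \<bullet> c) * (z \<bullet> z)" using Cauchy_Schwarz_ineq[of c z] by simp
    then show False using zz c by (simp add: hplane_iff)
  qed
  then have z: "z \<in> hplane" by (simp add: hplane_iff)
  have "(k * sqrt (1 - z \<bullet> z))\<^sup>2 = (1 - c \<bullet> z)\<^sup>2" using eq z by (simp add: power_mult_distrib hplane_iff)
  then have "k * sqrt (1 - z \<bullet> z) = 1 - c \<bullet> z"
    using hplane_inner_pos[OF c(1) z] hplane_sqrt_pos[OF z] c(2) by (simp add: power2_eq_iff_nonneg)
  then show "z \<in> circ c k" using z by (simp add: circ_def)
qed

text \<open>Here \<open>p\<close> and \<open>q\<close> are the signed tangent lengths from \<open>P\<close> and \<open>Q\<close>. Up to the factor \<open>k\<^sup>2\<close>, the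
  restriction to the line of the quadratic equation of the circle is minus a square.\<close>

lemma tangent_line_lengths:
  assumes c: "c \<in> hplane" "k > 0" and P: "P \<in> hplane" and Q: "Q \<in> hplane" and PQ: "P \<noteq> Q"
    and tang: "tangent_line_at (circ c k) P Q X"
  obtains t p q where "X = P + t *\<^sub>R (Q - P)"
    "mink (lift P) (pole c k) = cosh p" "mink (lift Q) (pole c k) = cosh q" "hcosh P Q = cosh (p + q)"
    "sgn p = sgn t" "sgn q = sgn (1 - t)"
proof -
  define V where "V = Q - P"
  have X: "X \<in> circ c k" "X \<in> affine hull {P, Q}"
    using tang by (auto simp: tangent_line_at_def hline_def)
  have uniq: "Z = X" if "Z \<in> circ c k" "Z \<in> affine hull {P, Q}" for Z
    using tang that by (auto simp: tangent_line_at_def hline_def circ_def)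
  have aff: "P + u *\<^sub>R V \<in> affine hull {P, Q}" for u
  proof -
    have "P + u *\<^sub>R V = (1 - u) *\<^sub>R P + u *\<^sub>R Q" by (simp add: V_def algebra_simps)
    then show ?thesis unfolding affine_hull_2 by force
  qed
  obtain t where t: "X = P + t *\<^sub>R V"
  proof -
    obtain a b where "X = a *\<^sub>R P + b *\<^sub>R Q" "a + b = 1" using X(2) unfolding affine_hull_2 by blast
    then have "X = P + b *\<^sub>R V" by (simp add: V_def algebra_simps flip: scaleR_add_left)
    then show thesis using that by blast
  qed
  define F where "F = (\<lambda>z. k\<^sup>2 * (1 - z \<bullet> z) - (1 - c \<bullet> z)\<^sup>2)"
  define \<kappa> b where "\<kappa> = k\<^sup>2 * (V \<bullet> V) + (c \<bullet> V)\<^sup>2" and "b = 2 * (c \<bullet> V) * (1 - c \<bullet> P) - 2 * k\<^sup>2 * (P \<bullet> V)"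
  have Fl: "F (P + u *\<^sub>R V) = - \<kappa> * u\<^sup>2 + b * u + F P" for u
    unfolding F_def inner_on_line unfolding inner_add_right inner_scaleR_right \<kappa>_def b_def by algebra
  have "V \<bullet> V > 0" using PQ by (simp add: V_def)
  then have \<kappa>: "\<kappa> > 0" using c by (simp add: \<kappa>_def add_pos_nonneg)
  have FX: "- \<kappa> * t\<^sup>2 + b * t + F P = 0"
    using X(1) mem_circ_quadratic[OF c] Fl[of t] by (simp add: t F_def)
  \<comment> \<open>The second root of the quadratic, from the sum of the roots. It is also a point
    of the circle, so tangency forces u = t.\<close>
  define u where "u = b / \<kappa> - t"
  have b: "b = \<kappa> * (t + u)" using \<kappa> by (simp add: u_def)
  have "F (P + u *\<^sub>R V) = 0" unfolding Fl using FX b by algebra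
  then have "P + u *\<^sub>R V = P + t *\<^sub>R V"
    using uniq[OF _ aff, of u] mem_circ_quadratic[OF c] by (simp add: F_def t)
  then have "u = t" using \<open>V \<bullet> V > 0\<close> by auto
  then have b: "b = 2 * \<kappa> * t" using b by simp
  have FP: "F P = - \<kappa> * t\<^sup>2" using FX b by algebra
  have FQ: "F Q = - \<kappa> * (1 - t)\<^sup>2"
  proof -
    have "F Q = - \<kappa> + b + F P" using Fl[of 1] by (simp add: V_def)
    then show ?thesis unfolding FP b by algebra
  qed
  \<comment> \<open>The polarised form of F at P and Q. As F restricts to minus \<kappa> times the
    square of (u - t), the parameters 0 and 1 give \<kappa> t (1 - t).\<close>
  have FPQ: "k\<^sup>2 * (1 - P \<bullet> Q) - (1 - c \<bullet> P) * (1 - c \<bullet> Q) = \<kappa> * t * (1 - t)"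
  proof -
    have "k\<^sup>2 * (1 - P \<bullet> Q) - (1 - c \<bullet> P) * (1 - c \<bullet> Q) = F P + b / 2"
      unfolding F_def b_def V_def inner_diff_right power2_eq_square by (simp add: field_simps)
    then show ?thesis unfolding FP b by algebra
  qed
  define \<alpha> \<beta> \<mu> where "\<alpha> = sqrt (1 - P \<bullet> P)" and "\<beta> = sqrt (1 - Q \<bullet> Q)" and "\<mu> = sqrt \<kappa> / k"
  have pos: "\<alpha> > 0" "\<beta> > 0" "\<mu> > 0" and sq: "\<alpha>\<^sup>2 = 1 - P \<bullet> P" "\<beta>\<^sup>2 = 1 - Q \<bullet> Q" "k\<^sup>2 * \<mu>\<^sup>2 = \<kappa>"
    using P Q c \<kappa> by (simp_all add: \<alpha>_def \<beta>_def \<mu>_def hplane_iff power_divide)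
  \<comment> \<open>With these choices FP and FQ read cosh^2 = 1 + sinh^2, and FPQ becomes the
    addition formula for cosh(p + q). The sinh is odd, so the position of the contact point survives
    as a sign.\<close>
  define p q where "p = arsinh (\<mu> * t / \<alpha>)" and "q = arsinh (\<mu> * (1 - t) / \<beta>)"
  define wP wQ where "wP = mink (lift P) (pole c k)" and "wQ = mink (lift Q) (pole c k)"
  have w: "1 - c \<bullet> P = k * \<alpha> * wP" "1 - c \<bullet> Q = k * \<beta> * wQ" "1 - P \<bullet> Q = \<alpha> * \<beta> * hcosh P Q"
    using pos c inner_hcosh[OF P Q] by (simp_all add: wP_def wQ_def mink_lift_pole \<alpha>_def \<beta>_def)
  have sh: "\<alpha> * sinh p = \<mu> * t" "\<beta> * sinh q = \<mu> * (1 - t)"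
    using pos by (simp_all add: p_def q_def)
  have "(k * \<alpha>)\<^sup>2 * wP\<^sup>2 = (k * \<alpha>)\<^sup>2 * (cosh p)\<^sup>2"
    using FP sq sh cosh_square_eq[of p] unfolding F_def w by algebra
  then have wP: "wP = cosh p"
    using pos c mink_lift_pole_pos[OF P c] by (simp add: wP_def power2_eq_iff_nonneg)
  have "(k * \<beta>)\<^sup>2 * wQ\<^sup>2 = (k * \<beta>)\<^sup>2 * (cosh q)\<^sup>2"
    using FQ sq sh cosh_square_eq[of q] unfolding F_def w by algebra
  then have wQ: "wQ = cosh q"
    using pos c mink_lift_pole_pos[OF Q c] by (simp add: wQ_def power2_eq_iff_nonneg)
  have "(k\<^sup>2 * \<alpha> * \<beta>) * hcosh P Q = (k\<^sup>2 * \<alpha> * \<beta>) * cosh (p + q)"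
    using FPQ sq(3) sh unfolding w wP wQ cosh_add by algebra
  then have "hcosh P Q = cosh (p + q)" using pos c by simp
  moreover have "sgn p = sgn t" "sgn q = sgn (1 - t)"
    using pos by (simp_all add: p_def q_def sgn_real_def zero_less_mult_iff zero_less_divide_iff)
  ultimately show thesis
    using that[of t p q] t wP wQ by (simp add: V_def wP_def wQ_def)
qed

section \<open>Feuerbach circle and tritangent circles\<close>

text \<open>The determinant of the Gram matrix of three unit vectors, where A is the product of the
  second and third vectors, B of the third and first, C of the first and second.\<close>

definition gram :: "real \<Rightarrow> real \<Rightarrow> real \<Rightarrow> real" where
  "gram A B C = 1 + 2*A*B*C - A\<^sup>2 - B\<^sup>2 - C\<^sup>2"

text \<open>The bilinear form of the adjugate of that Gram matrix.\<close>

definition adj_form :: "real \<Rightarrow> real \<Rightarrow> real \<Rightarrow> real \<Rightarrow> real \<Rightarrow> real \<Rightarrow> real \<Rightarrow> real \<Rightarrow> real \<Rightarrow> real" where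
  "adj_form A B C s1 s2 s3 t1 t2 t3 =
     (1 - A\<^sup>2) * s1 * t1 + (1 - B\<^sup>2) * s2 * t2 + (1 - C\<^sup>2) * s3 * t3
     + (A*B - C) * (s1*t2 + s2*t1) + (A*C - B) * (s1*t3 + s3*t1) + (B*C - A) * (s2*t3 + s3*t2)"

text \<open>Two vectors are compared through their products with a, b, c, by the inverse Gram matrix
  cleared of its determinant. With <a, a>, <b, b>, <c, c> kept in place of 1, this is an
  unconditional polynomial identity in the coordinates.\<close>

lemma gram_adj:
  assumes "mink a a = 1" "mink b b = 1" "mink c c = 1"
  shows "gram (mink b c) (mink c a) (mink a b) * mink u v =
     adj_form (mink b c) (mink c a) (mink a b) (mink a u) (mink b u) (mink c u) (mink a v) (mink b v) (mink c v)"
proof -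
  have "(mink a a * mink b b * mink c c + 2 * mink b c * mink c a * mink a b - mink a a * (mink b c)\<^sup>2 - mink b b * (mink c a)\<^sup>2 - mink c c * (mink a b)\<^sup>2) * mink u v = 
   (mink b b * mink c c - (mink b c)\<^sup>2) * mink a u * mink a v + (mink a a * mink c c - (mink c a)\<^sup>2) * mink b u * mink b v + (mink a a * mink b b - (mink a b)\<^sup>2) * mink c u * mink c v
     + (mink b c * mink c a - mink c c * mink a b) * (mink a u * mink b v + mink b u * mink a v) + (mink b c * mink a b - mink b b * mink c a) * (mink a u * mink c v + mink c u * mink a v) + (mink c a * mink a b - mink a a * mink b c) * (mink b u * mink c v + mink c u * mink b v)"
    unfolding mink_def inner_vec_def sum_2 inner_real_def by algebra
  then show ?thesis unfolding assms gram_def adj_form_def by (simp add: algebra_simps)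
qed

text \<open>For x, y, z the cosh of the half-sides, the factors on the right are squares of sinh;
  this and the next two identities supply 4 H^2, 4 S^2 and 4 H S.\<close>

lemma gram_adj_omega:
  fixes x y z :: real
  assumes "x > 0" "y > 0" "z > 0"
  shows "gram (2*x\<^sup>2 - 1) (2*y\<^sup>2 - 1) (2*z\<^sup>2-1) - adj_form (2*x\<^sup>2 - 1) (2*y\<^sup>2 - 1) (2*z\<^sup>2-1) (y*z/x) (x*z/y) (x*y/z) (y*z/x) (x*z/y) (x*y/z)
    = 4 * ((x\<^sup>2-1)*(y\<^sup>2-1)*(z\<^sup>2-1))"
  using assms unfolding gram_def adj_form_def by (simp add: divide_simps) algebra

text \<open>Here x, y, z are the signed tangent lengths at the three vertices, and the sides are
  their pairwise sums.\<close>

lemma gram_adj_tritangent: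
  fixes x y z :: real
  shows "gram (cosh (y+z)) (cosh (x+z)) (cosh (x+y)) - adj_form (cosh (y+z)) (cosh (x+z)) (cosh (x+y)) (cosh x) (cosh y) (cosh z) (cosh x) (cosh y) (cosh z)
    = 4 * ((sinh x)\<^sup>2*(sinh y)\<^sup>2*(sinh z)\<^sup>2)"
  using cosh_square_eq[of x] cosh_square_eq[of y] cosh_square_eq[of z] unfolding gram_def adj_form_def cosh_add by algebra

lemma gram_adj_mixed:
  fixes p q r :: real
  shows "gram (cosh (2*p)) (cosh (2*q)) (cosh (2*r)) - adj_form (cosh (2*p)) (cosh (2*q)) (cosh (2*r)) (cosh q * cosh r/cosh p) (cosh p * cosh r/cosh q) (cosh p * cosh q/cosh r) (cosh (q+r-p)) (cosh (p+r-q)) (cosh (p+q-r))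
    = 4 * (sinh p * sinh q * sinh r * sinh (q+r-p) * sinh (p+r-q) * sinh (p+q-r))"
proof -
  have "cosh p \<noteq> 0" "cosh q \<noteq> 0" "cosh r \<noteq> 0" using cosh_real_pos less_irrefl by metis+
  then show ?thesis
  using cosh_square_eq[of p] cosh_square_eq[of q] cosh_square_eq[of r] 
  unfolding gram_def adj_form_def cosh_double cosh_add sinh_add cosh_diff sinh_diff 
  by (simp add: divide_simps) algebra
qed

text \<open>Scaling the lifts back to (1, A), (1, B), (1, C) turns the Gram determinant into the
  square of \<open>cross2\<close>.\<close>

lemma gram_pos:
  assumes A: "A \<in> hplane" and B: "B \<in> hplane" and C: "C \<in> hplane" and nz: "cross2 A B C \<noteq> 0"
  shows "gram (hcosh B C) (hcosh C A) (hcosh A B) > 0"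
proof -
  define \<alpha> \<beta> \<gamma> where "\<alpha> = sqrt (1 - A \<bullet> A)" and "\<beta> = sqrt (1 - B \<bullet> B)" and "\<gamma> = sqrt (1 - C \<bullet> C)"
  have pos: "\<alpha> > 0" "\<beta> > 0" "\<gamma> > 0" and sq: "\<alpha>\<^sup>2 = 1 - A \<bullet> A" "\<beta>\<^sup>2 = 1 - B \<bullet> B" "\<gamma>\<^sup>2 = 1 - C \<bullet> C"
    using A B C by (simp_all add: \<alpha>_def \<beta>_def \<gamma>_def hplane_iff)
  have "(\<alpha> * \<beta> * \<gamma>)\<^sup>2 * gram (hcosh B C) (hcosh C A) (hcosh A B) =
    \<alpha>\<^sup>2 * \<beta>\<^sup>2 * \<gamma>\<^sup>2 + 2 * (1 - B \<bullet> C) * (1 - C \<bullet> A) * (1 - A \<bullet> B)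
      - \<alpha>\<^sup>2 * (1 - B \<bullet> C)\<^sup>2 - \<beta>\<^sup>2 * (1 - C \<bullet> A)\<^sup>2 - \<gamma>\<^sup>2 * (1 - A \<bullet> B)\<^sup>2"
    unfolding inner_hcosh[OF A B] inner_hcosh[OF B C] inner_hcosh[OF C A] gram_def
      \<alpha>_def[symmetric] \<beta>_def[symmetric] \<gamma>_def[symmetric] by algebra
  also have "\<dots> = (cross2 A B C)\<^sup>2"
    unfolding sq cross2_def inner_vec_def sum_2 inner_real_def by algebra
  finally have "(\<alpha> * \<beta> * \<gamma>)\<^sup>2 * gram (hcosh B C) (hcosh C A) (hcosh A B) > 0" using nz by simp
  then show ?thesis using pos by (simp add: zero_less_mult_iff)
qed

text \<open>For the escribed circle opposite \<open>A\<close>, \<open>p\<close> is minus half the side \<open>BC\<close>.\<close>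

lemma tritangent_circle_tangent:
  fixes p q r :: real
  assumes A: "A \<in> hplane" and B: "B \<in> hplane" and C: "C \<in> hplane" and nz: "cross2 A B C \<noteq> 0"
    and sides: "hcosh B C = cosh (2 * p)" "hcosh C A = cosh (2 * q)" "hcosh A B = cosh (2 * r)"
    and c: "c \<in> hplane" "k > 0" and c': "c' \<in> hplane" "k' > 0"
    and w: "mink (lift A) (pole c k) = cosh q * cosh r / cosh p" "mink (lift B) (pole c k) = cosh p * cosh r / cosh q"
      "mink (lift C) (pole c k) = cosh p * cosh q / cosh r"
    and v: "mink (lift A) (pole c' k') = cosh (q + r - p)" "mink (lift B) (pole c' k') = cosh (p + r - q)"
      "mink (lift C) (pole c' k') = cosh (p + q - r)"
  shows "tangent_circles (circ c k) (circ c' k')"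
proof (rule tangent_circ_circ[OF c c'])
  define \<omega> \<omega>' \<Delta> where "\<omega> = pole c k" and "\<omega>' = pole c' k'" and "\<Delta> = gram (cosh (2 * p)) (cosh (2 * q)) (cosh (2 * r))"
  define H S where "H = sinh p * sinh q * sinh r" and "S = sinh (q + r - p) * sinh (p + r - q) * sinh (p + q - r)"
  have \<Delta>: "\<Delta> \<noteq> 0" using gram_pos[OF A B C nz] by (simp add: sides \<Delta>_def)
  note G = gram_adj[OF A[THEN mink_lift_self] B[THEN mink_lift_self] C[THEN mink_lift_self],
      unfolded mink_lift_lift sides, folded \<Delta>_def]
  have 1: "\<Delta> * (1 - mink \<omega> \<omega>) = 4 * H\<^sup>2"
  proof -
    have "\<Delta> * mink \<omega> \<omega> = \<Delta> - 4 * ((cosh p)\<^sup>2 - 1) * ((cosh q)\<^sup>2 - 1) * ((cosh r)\<^sup>2 - 1)"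
      using gram_adj_omega[OF cosh_real_pos[of p] cosh_real_pos[of q] cosh_real_pos[of r]]
      unfolding G \<omega>_def w unfolding cosh_double_cosh[symmetric] \<Delta>_def by linarith
    then show ?thesis by (simp add: H_def cosh_square_eq power_mult_distrib algebra_simps)
  qed
  have 2: "\<Delta> * (1 - mink \<omega>' \<omega>') = 4 * S\<^sup>2"
    using gram_adj_tritangent[of "p + r - q" "p + q - r" "q + r - p"]
    unfolding right_diff_distrib G \<omega>'_def v
    by (simp add: S_def power_mult_distrib \<Delta>_def)
  have 3: "\<Delta> * (1 - mink \<omega> \<omega>') = 4 * (H * S)"
    using gram_adj_mixed[of p q r]
    unfolding right_diff_distrib G \<omega>_def \<omega>'_def v w by (simp add: S_def H_def \<Delta>_def)
  \<comment> \<open>Both sides are 16 H^2 S^2.\<close>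
  have "\<Delta>\<^sup>2 * ((1 - mink \<omega> \<omega>) * (1 - mink \<omega>' \<omega>')) = \<Delta>\<^sup>2 * (1 - mink \<omega> \<omega>')\<^sup>2"
    using 1 2 3 by algebra
  then show "(1 - mink (pole c k) (pole c k)) * (1 - mink (pole c' k') (pole c' k')) = (1 - mink (pole c k) (pole c' k'))\<^sup>2"
    using \<Delta> by (simp add: \<omega>_def \<omega>'_def)
qed

text \<open>The two relations for the foot give s = p f + q g, while incidence with the circle gives
  s = p wB + q wC. Hence p (wB - f) + q (wC - g) = 0, and p : q is 1 / (1 + f) : 1 / (1 + g). Each
  resulting summand depends only on its vertex, so the same term recurs for the foot on the other
  adjacent side.\<close>

lemma area_bisector_foot_on_circ:
  assumes A: "A \<in> hplane" and B: "B \<in> hplane" and C: "C \<in> hplane" and nz: "cross2 A B C \<noteq> 0"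
    and foot: "area_bisector_foot M A B C" and c: "c \<in> hplane" "k > 0" and M: "M \<in> circ c k"
  defines "x \<equiv> hcosh_half B C" and "y \<equiv> hcosh_half C A" and "z \<equiv> hcosh_half A B"
  shows "(mink (lift B) (pole c k) - z * x / y) / (1 + z * x / y) + (mink (lift C) (pole c k) - x * y / z) / (1 + x * y / z) = 0"
proof -
  obtain t where t: "0 < t" "t < 1" "M = B + t *\<^sub>R (C - B)"
    and u: "sqrt (1 - M \<bullet> M) + t * sqrt (1 - C \<bullet> C) - (1 - t) * sqrt (1 - B \<bullet> B) = 2 * ((1 - t) * sqrt (1 - B \<bullet> B)) * (z * x / y)"
    and v: "sqrt (1 - M \<bullet> M) + (1 - t) * sqrt (1 - B \<bullet> B) - t * sqrt (1 - C \<bullet> C) = 2 * (t * sqrt (1 - C \<bullet> C)) * (x * y / z)"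
    using area_bisector_foot_position[OF A B C nz foot] unfolding x_def y_def z_def by blast
  define wB wC where "wB = mink (lift B) (pole c k)" and "wC = mink (lift C) (pole c k)"
  define p q s where "p = (1 - t) * sqrt (1 - B \<bullet> B)" and "q = t * sqrt (1 - C \<bullet> C)" and "s = sqrt (1 - M \<bullet> M)"
  define f g where "f = z * x / y" and "g = x * y / z"
  have "x > 0" "y > 0" "z > 0"
    unfolding x_def y_def z_def using hcosh_half_pos[OF B C] hcosh_half_pos[OF C A] hcosh_half_pos[OF A B] by auto
  then have fg: "f > 0" "g > 0" by (simp_all add: f_def g_def)
  have p: "p > 0" using t B by (simp add: p_def hplane_iff)
  have uv: "s + q - p = 2 * p * f" "s + p - q = 2 * q * g"
    using u v by (simp_all add: p_def q_def s_def f_def g_def)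
  have w: "1 - c \<bullet> B = k * (sqrt (1 - B \<bullet> B) * wB)" "1 - c \<bullet> C = k * (sqrt (1 - C \<bullet> C) * wC)"
    using c hplane_sqrt_pos[OF B] hplane_sqrt_pos[OF C] by (simp_all add: wB_def wC_def mink_lift_pole)
  have "k * s = 1 - c \<bullet> M" using M by (simp add: circ_def s_def)
  also have "\<dots> = (1 - t) * (1 - c \<bullet> B) + t * (1 - c \<bullet> C)"
    by (simp add: t inner_add_right inner_diff_right algebra_simps)
  also have "\<dots> = k * (p * wB + q * wC)"
    unfolding w p_def q_def by algebra
  finally have s: "s = p * wB + q * wC" using c by simp
  \<comment> \<open>Both sides are (s + p + q) / 2.\<close>
  have qp: "q * (1 + g) = p * (1 + f)" using uv by algebra
  have "p * (1 + f) * ((wB - f) / (1 + f) + (wC - g) / (1 + g)) = p * (wB - f) + q * (wC - g)"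
  proof -
    have "p * (1 + f) * ((wB - f) / (1 + f)) = p * (wB - f)" using fg by simp
    moreover have "p * (1 + f) * ((wC - g) / (1 + g)) = q * (wC - g)" unfolding qp[symmetric] using fg by simp
    ultimately show ?thesis by (simp only: distrib_left)
  qed
  also have "\<dots> = 0" using s uv by algebra
  finally show ?thesis using p fg by (simp add: wB_def wC_def f_def g_def)
qed

lemma feet_circ_poles:
  assumes A: "A \<in> hplane" and B: "B \<in> hplane" and C: "C \<in> hplane" and nz: "cross2 A B C \<noteq> 0"
    and feet: "area_bisector_foot Ma A B C" "area_bisector_foot Mb B C A" "area_bisector_foot Mc C A B"
    and c: "c \<in> hplane" "k > 0" and M: "Ma \<in> circ c k" "Mb \<in> circ c k" "Mc \<in> circ c k"
  shows "mink (lift A) (pole c k) = hcosh_half C A * hcosh_half A B / hcosh_half B C"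
proof -
  define x y z where "x = hcosh_half B C" and "y = hcosh_half C A" and "z = hcosh_half A B"
  have "cross2 B C A \<noteq> 0" "cross2 C A B \<noteq> 0" using nz by (simp_all add: cross2_def algebra_simps)
  note E = area_bisector_foot_on_circ[OF A B C nz feet(1) c M(1)]
    area_bisector_foot_on_circ[OF B C A this(1) feet(2) c M(2)]
    area_bisector_foot_on_circ[OF C A B this(2) feet(3) c M(3)]
  have "x > 0" "y > 0" "z > 0"
    unfolding x_def y_def z_def using hcosh_half_pos[OF B C] hcosh_half_pos[OF C A] hcosh_half_pos[OF A B] by auto
  then have "1 + y * z / x > 0" by (simp add: add_pos_pos)
  moreover have "(mink (lift A) (pole c k) - y * z / x) / (1 + y * z / x) = 0"
  proof -
    \<comment> \<open>The three feet say that the scaled deviations at the vertices cancel in pairs,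
      so every one of them vanishes.\<close>
    have "a = 0" if "b + c = 0" "c + a = 0" "a + b = 0" for a b c :: real using that by linarith
    from this[OF E] show ?thesis by (simp only: x_def y_def z_def)
  qed
  ultimately show ?thesis by (simp add: x_def y_def z_def)
qed

lemma hcosh_half_eq_cosh: "hcosh P Q = cosh (2 * r) \<Longrightarrow> hcosh_half P Q = cosh r"
  by (simp add: hcosh_half_def cosh_double_cosh)

section \<open>Affine coordinates relative to the triangle\<close>

lemma htriangle_cross2:
  assumes "htriangle A B C"
  shows "cross2 A B C \<noteq> 0"
proof
  assume eq: "cross2 A B C = 0"
  have "collinear {A, C, B}"
  proof (cases "A = B")
    case False
    define u where "u = (C - B) \<bullet> (A - B) / ((A - B) \<bullet> (A - B))"
    have "(A - B) \<bullet> (A - B) \<noteq> 0" using False by simp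
    then have u: "u * ((A - B) \<bullet> (A - B)) = (C - B) \<bullet> (A - B)" by (simp add: u_def)
    have "((A - B) \<bullet> (A - B)) * (C $ 1 - B $ 1) = ((C - B) \<bullet> (A - B)) * (A $ 1 - B $ 1)"
      "((A - B) \<bullet> (A - B)) * (C $ 2 - B $ 2) = ((C - B) \<bullet> (A - B)) * (A $ 2 - B $ 2)"
      using eq unfolding cross2_def inner_vec_def sum_2 inner_real_def vector_minus_component by algebra+
    then have "((A - B) \<bullet> (A - B)) * (C $ i - B $ i) = (u * ((A - B) \<bullet> (A - B))) * (A $ i - B $ i)" for i
      unfolding u using exhaust_2[of i] by metis
    then have "((A - B) \<bullet> (A - B)) * (C $ i - B $ i) = ((A - B) \<bullet> (A - B)) * (u * (A $ i - B $ i))" for i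
      by (simp only: mult_ac)
    then have "C $ i - B $ i = u * (A $ i - B $ i)" for i
      using \<open>(A - B) \<bullet> (A - B) \<noteq> 0\<close> mult_cancel_left by blast
    then have "C $ i = (u *\<^sub>R A + (1 - u) *\<^sub>R B) $ i" for i
      by (simp add: algebra_simps)
    then have "C = u *\<^sub>R A + (1 - u) *\<^sub>R B" by (simp add: vec_eq_iff)
    then show ?thesis unfolding collinear_3_expand by blast
  next
    case True
    then have "{A, C, B} = {A, C}" by auto
    then show ?thesis by simp
  qed
  then show False using assms by (simp add: htriangle_def insert_commute)
qed

lemma affine_coordinates_unique:
  assumes nz: "cross2 A B C \<noteq> 0"
    and eq: "A + s *\<^sub>R (B - A) + t *\<^sub>R (C - A) = A + s' *\<^sub>R (B - A) + t' *\<^sub>R (C - A)"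
  shows "s = s' \<and> t = t'"
proof -
  have "(A + s *\<^sub>R (B - A) + t *\<^sub>R (C - A)) $ i = (A + s' *\<^sub>R (B - A) + t' *\<^sub>R (C - A)) $ i" for i
    using arg_cong[OF eq, of "\<lambda>v. v $ i"] .
  from this[of 1] this[of 2]
  have "(s - s') * (B$1 - A$1) + (t - t') * (C$1 - A$1) = 0" "(s - s') * (B$2 - A$2) + (t - t') * (C$2 - A$2) = 0"
    by (simp_all add: algebra_simps)
  then have "(s - s') * cross2 A B C = 0" "(t - t') * cross2 A B C = 0"
    unfolding cross2_def by algebra+
  then show ?thesis using nz by simp
qed

text \<open>Moving from A towards X scales both coordinates by some l <= 1, and the line BC is where
  they sum to 1; thus l (s + t) = 1.\<close>

lemma other_side_coordinates:
  assumes nz: "cross2 A B C \<noteq> 0" and X: "A + s *\<^sub>R (B - A) + t *\<^sub>R (C - A) \<in> other_side A B C"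
  shows "s + t \<ge> 1"
proof -
  obtain Y where Y: "Y \<in> closed_segment A (A + s *\<^sub>R (B - A) + t *\<^sub>R (C - A))" "Y \<in> affine hull {B, C}"
    using X by (auto simp: other_side_def hline_def)
  obtain l where l: "0 \<le> l" "l \<le> 1" "Y = (1 - l) *\<^sub>R A + l *\<^sub>R (A + s *\<^sub>R (B - A) + t *\<^sub>R (C - A))"
    using Y(1) by (auto simp: in_segment)
  obtain u v where uv: "Y = u *\<^sub>R B + v *\<^sub>R C" "u + v = 1"
    using Y(2) unfolding affine_hull_2 by blast
  have "A + (l * s) *\<^sub>R (B - A) + (l * t) *\<^sub>R (C - A) = Y"
    unfolding l by (simp add: algebra_simps)
  also have "Y = A + u *\<^sub>R (B - A) + v *\<^sub>R (C - A)"
  proof -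
    have "u *\<^sub>R A + v *\<^sub>R A = A" using uv(2) by (metis scaleR_add_left scaleR_one)
    then show ?thesis unfolding uv(1) by (simp add: algebra_simps)
  qed
  finally have "l * s = u \<and> l * t = v" by (rule affine_coordinates_unique[OF nz])
  then have "l * (s + t) = 1" using uv by (simp add: distrib_left)
  then show ?thesis using l mult_left_le_one_le[of "s + t" l] by (smt (verit) mult_nonneg_nonpos)
qed

lemma cosh_eq_cosh_nonneg: "cosh p = cosh q \<Longrightarrow> p \<ge> 0 \<Longrightarrow> q \<ge> 0 \<Longrightarrow> p = (q::real)"
  by (metis abs_of_nonneg cosh_real_nonneg_le_iff order_antisym order_refl)

section \<open>Tangent lengths of the inscribed and escribed circles\<close>

lemma tangent_side_lengths:
  assumes c: "c \<in> hplane" "k > 0" and P: "P \<in> hplane" and Q: "Q \<in> hplane" and PQ: "P \<noteq> Q"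
    and tang: "tangent_side (circ c k) P Q"
  obtains p q where "mink (lift P) (pole c k) = cosh p" "mink (lift Q) (pole c k) = cosh q"
    "hcosh P Q = cosh (p + q)" "p \<ge> 0" "q \<ge> 0"
proof -
  obtain X where X: "X \<in> closed_segment P Q" "tangent_line_at (circ c k) P Q X"
    using tang by (auto simp: tangent_side_def)
  obtain t p q where t: "X = P + t *\<^sub>R (Q - P)"
    and pq: "mink (lift P) (pole c k) = cosh p" "mink (lift Q) (pole c k) = cosh q" "hcosh P Q = cosh (p + q)"
    and sgn: "sgn p = sgn t" "sgn q = sgn (1 - t)"
    using tangent_line_lengths[OF c P Q PQ X(2)] by blast
  obtain u where u: "0 \<le> u" "u \<le> 1" "X = P + u *\<^sub>R (Q - P)"
    using X(1) by (auto simp: in_segment algebra_simps)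
  then have "u = t" using t PQ by simp
  then have "p \<ge> 0" "q \<ge> 0" using sgn u by (auto simp: sgn_real_def split: if_splits)
  then show thesis using that pq by blast
qed

lemma inscribed_circle_tangent:
  assumes A: "A \<in> hplane" and B: "B \<in> hplane" and C: "C \<in> hplane" and nz: "cross2 A B C \<noteq> 0"
    and c: "c \<in> hplane" "k > 0"
    and w: "mink (lift A) (pole c k) = hcosh_half C A * hcosh_half A B / hcosh_half B C"
      "mink (lift B) (pole c k) = hcosh_half A B * hcosh_half B C / hcosh_half C A"
      "mink (lift C) (pole c k) = hcosh_half B C * hcosh_half C A / hcosh_half A B"
    and S: "inscribed_circle S A B C"
  shows "tangent_circles (circ c k) S"
proof -
  have ne: "B \<noteq> C" "C \<noteq> A" "A \<noteq> B" using nz by (auto simp: cross2_def algebra_simps)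
  obtain c' k' where c': "c' \<in> hplane" "k' > 0" "S = circ c' k'"
    using S is_hcircle_circ by (auto simp: inscribed_circle_def)
  note tang = S[unfolded inscribed_circle_def c'(3)]
  obtain v1 w1 where 1: "mink (lift B) (pole c' k') = cosh v1" "mink (lift C) (pole c' k') = cosh w1"
    "hcosh B C = cosh (v1 + w1)" "v1 \<ge> 0" "w1 \<ge> 0"
    using tangent_side_lengths[OF c'(1,2) B C ne(1)] tang by blast
  obtain w2 u2 where 2: "mink (lift C) (pole c' k') = cosh w2" "mink (lift A) (pole c' k') = cosh u2"
    "hcosh C A = cosh (w2 + u2)" "w2 \<ge> 0" "u2 \<ge> 0"
    using tangent_side_lengths[OF c'(1,2) C A ne(2)] tang by blast
  obtain u3 v3 where 3: "mink (lift A) (pole c' k') = cosh u3" "mink (lift B) (pole c' k') = cosh v3"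
    "hcosh A B = cosh (u3 + v3)" "u3 \<ge> 0" "v3 \<ge> 0"
    using tangent_side_lengths[OF c'(1,2) A B ne(3)] tang by blast
  \<comment> \<open>The product of a vertex with the pole is the cosh of its tangent length on
    either adjacent side; nonnegative lengths with the same cosh are equal.\<close>
  have eqs: "w2 = w1" "u3 = u2" "v3 = v1"
    using 1 2 3 by (auto intro: cosh_eq_cosh_nonneg)
  define p q r where "p = (v1 + w1) / 2" and "q = (w1 + u2) / 2" and "r = (u2 + v1) / 2"
  have sides: "hcosh B C = cosh (2 * p)" "hcosh C A = cosh (2 * q)" "hcosh A B = cosh (2 * r)"
    using 1 2 3 eqs by (simp_all add: p_def q_def r_def)
  have lengths: "q + r - p = u2" "p + r - q = v1" "p + q - r = w1"
    by (simp_all add: p_def q_def r_def field_simps)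
  show ?thesis
    unfolding c'(3)
    by (rule tritangent_circle_tangent[OF A B C nz sides c c'(1,2)])
      (simp_all add: w lengths 1 2 sides[THEN hcosh_half_eq_cosh] mult.commute)
qed

lemma escribed_circle_tangent:
  assumes A: "A \<in> hplane" and B: "B \<in> hplane" and C: "C \<in> hplane" and nz: "cross2 A B C \<noteq> 0"
    and c: "c \<in> hplane" "k > 0"
    and w: "mink (lift A) (pole c k) = hcosh_half C A * hcosh_half A B / hcosh_half B C"
      "mink (lift B) (pole c k) = hcosh_half A B * hcosh_half B C / hcosh_half C A"
      "mink (lift C) (pole c k) = hcosh_half B C * hcosh_half C A / hcosh_half A B"
    and S: "escribed_circle S A B C"
  shows "tangent_circles (circ c k) S"
proof -
  have ne: "B \<noteq> C" "C \<noteq> A" "A \<noteq> B" using nz by (auto simp: cross2_def algebra_simps)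
  obtain c' k' where c': "c' \<in> hplane" "k' > 0" "S = circ c' k'"
    using S is_hcircle_circ by (auto simp: escribed_circle_def)
  have sub: "S \<subseteq> hangle B A C" "S \<subseteq> other_side A B C"
    using S by (auto simp: escribed_circle_def)
  obtain X1 X2 X3 where X: "tangent_line_at (circ c' k') B C X1" "tangent_line_at (circ c' k') C A X2"
      "tangent_line_at (circ c' k') A B X3"
    using S unfolding escribed_circle_def tangent_line_def c'(3) by blast
  then have XS: "X1 \<in> S" "X2 \<in> S" "X3 \<in> S" by (auto simp: tangent_line_at_def c'(3))
  obtain t1 v1 w1 where 1: "X1 = B + t1 *\<^sub>R (C - B)" "mink (lift B) (pole c' k') = cosh v1"
    "mink (lift C) (pole c' k') = cosh w1" "hcosh B C = cosh (v1 + w1)" "sgn v1 = sgn t1" "sgn w1 = sgn (1 - t1)"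
    using tangent_line_lengths[OF c'(1,2) B C ne(1) X(1)] by blast
  obtain t2 w2 u2 where 2: "X2 = C + t2 *\<^sub>R (A - C)" "mink (lift C) (pole c' k') = cosh w2"
    "mink (lift A) (pole c' k') = cosh u2" "hcosh C A = cosh (w2 + u2)" "sgn w2 = sgn t2" "sgn u2 = sgn (1 - t2)"
    using tangent_line_lengths[OF c'(1,2) C A ne(2) X(2)] by blast
  obtain t3 u3 v3 where 3: "X3 = A + t3 *\<^sub>R (B - A)" "mink (lift A) (pole c' k') = cosh u3"
    "mink (lift B) (pole c' k') = cosh v3" "hcosh A B = cosh (u3 + v3)" "sgn u3 = sgn t3" "sgn v3 = sgn (1 - t3)"
    using tangent_line_lengths[OF c'(1,2) A B ne(3) X(3)] by blast
  \<comment> \<open>X1 lies on BC and in the angle at A, so its coordinates 1 - t1 and t1 are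
    nonnegative: the contact is between B and C.\<close>
  have "0 \<le> 1 - t1 \<and> 0 \<le> t1"
  proof -
    have X1: "X1 = A + (1 - t1) *\<^sub>R (B - A) + t1 *\<^sub>R (C - A)" unfolding 1 by (simp add: algebra_simps)
    obtain s t where "0 \<le> s" "0 \<le> t" "X1 = A + s *\<^sub>R (B - A) + t *\<^sub>R (C - A)"
      using XS(1) sub(1) unfolding hangle_def by blast
    with affine_coordinates_unique[OF nz, of "1 - t1" t1 s t] X1 show ?thesis by simp
  qed
  then have pos1: "v1 \<ge> 0" "w1 \<ge> 0" using 1 by (auto simp: sgn_real_def split: if_splits)
  \<comment> \<open>The contact on CA lies at or beyond C as seen from A, which makes the length at
    C nonpositive along this line; the same happens at B on the line AB.\<close>
  have "t2 \<le> 0"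
  proof -
    have "X2 = A + 0 *\<^sub>R (B - A) + (1 - t2) *\<^sub>R (C - A)" unfolding 2 by (simp add: algebra_simps)
    then show ?thesis using other_side_coordinates[OF nz, of 0 "1 - t2"] XS(2) sub(2) by auto
  qed
  then have pos2: "- w2 \<ge> 0" "u2 \<ge> 0" using 2 by (auto simp: sgn_real_def split: if_splits)
  have "t3 \<ge> 1"
  proof -
    have "X3 = A + t3 *\<^sub>R (B - A) + 0 *\<^sub>R (C - A)" unfolding 3 by simp
    then show ?thesis using other_side_coordinates[OF nz, of t3 0] XS(3) sub(2) by auto
  qed
  then have pos3: "u3 \<ge> 0" "- v3 \<ge> 0" using 3 by (auto simp: sgn_real_def split: if_splits)
  have "- w2 = w1" "u3 = u2" "- v3 = v1"
    using 1 2 3 pos1 pos2 pos3 by (auto intro!: cosh_eq_cosh_nonneg)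
  then have eqs: "w2 = - w1" "u3 = u2" "v3 = - v1" by simp_all
  \<comment> \<open>Negating the half-side p leaves cosh (2 * p) unchanged. It turns the
    inscribed-circle expressions q + r - p, p + r - q, p + q - r into u2, - v1, - w1, whose cosh are
    the required products.\<close>
  define p q r where "p = - (v1 + w1) / 2" and "q = (u2 - w1) / 2" and "r = (u2 - v1) / 2"
  have "2 * p = - (v1 + w1)" "2 * q = w2 + u2" "2 * r = u3 + v3"
    by (simp_all add: p_def q_def r_def eqs)
  then have sides: "hcosh B C = cosh (2 * p)" "hcosh C A = cosh (2 * q)" "hcosh A B = cosh (2 * r)"
    using 1(4) 2(4) 3(4) by (simp_all only: cosh_minus)
  have lengths: "q + r - p = u2" "p + r - q = - v1" "p + q - r = - w1"
    by (simp_all add: p_def q_def r_def field_simps)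
  show ?thesis
    unfolding c'(3)
    by (rule tritangent_circle_tangent[OF A B C nz sides c c'(1,2)])
      (simp_all add: w lengths 1(2,3) 2(3) sides[THEN hcosh_half_eq_cosh] mult.commute)
qed

theorem mainTheorem1:
  fixes A B C Ma Mb Mc :: point
    and \<Omega> \<I> Ea Eb Ec :: "point set"
  assumes "htriangle A B C"
    and "area_bisector_foot Ma A B C"
    and "area_bisector_foot Mb B C A"
    and "area_bisector_foot Mc C A B"
    and "is_hcircle \<Omega>"
    and "Ma \<in> \<Omega>" and "Mb \<in> \<Omega>" and "Mc \<in> \<Omega>"
    and "inscribed_circle \<I> A B C"
    and "escribed_circle Ea A B C"
    and "escribed_circle Eb B C A"
    and "escribed_circle Ec C A B"
  shows "tangent_circles \<Omega> \<I> \<and> tangent_circles \<Omega> Ea \<and>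
         tangent_circles \<Omega> Eb \<and> tangent_circles \<Omega> Ec"
proof -
  have A: "A \<in> hplane" and B: "B \<in> hplane" and C: "C \<in> hplane"
    using assms(1) by (auto simp: htriangle_def)
  have nz: "cross2 A B C \<noteq> 0" by (rule htriangle_cross2[OF assms(1)])
  have nz': "cross2 B C A \<noteq> 0" "cross2 C A B \<noteq> 0" using nz by (simp_all add: cross2_def algebra_simps)
  obtain c k where c: "c \<in> hplane" "k > 0" and \<Omega>: "\<Omega> = circ c k"
    using assms(5) is_hcircle_circ by blast
  note M = assms(6-8)[unfolded \<Omega>]
  \<comment> \<open>The configuration is invariant under cyclic relabelling, so the product for the
    first vertex yields those for the other two.\<close>
  note wA = feet_circ_poles[OF A B C nz assms(2-4) c M]
  note wB = feet_circ_poles[OF B C A nz'(1) assms(3,4,2) c M(2,3,1)]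
  note wC = feet_circ_poles[OF C A B nz'(2) assms(4,2,3) c M(3,1,2)]
  show ?thesis
    unfolding \<Omega>
    using inscribed_circle_tangent[OF A B C nz c wA wB wC assms(9)]
      escribed_circle_tangent[OF A B C nz c wA wB wC assms(10)]
      escribed_circle_tangent[OF B C A nz'(1) c wB wC wA assms(11)]
      escribed_circle_tangent[OF C A B nz'(2) c wC wA wB assms(12)]
    by blast
qed

end
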